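(* Let $S = S (Z ^{\ell },\sigma )$ be a normalized, properly embedded Dedekind sum. Then we may write $$S = \sum_{\varrho \in R} q_{\varrho }S (Z^{\ell},\varrho )+\sum_{\tau \in T} q_{\tau }S (Z^{\ell-1 },\tau),$$ where (1) the sets $R$ and $T$ are finite, (2) $q_{\varrho }, q_{\tau }\in \mathbb{Q}$, (3) each $S (Z^{\ell },\varrho)$ is diagonal, and (4) each of the Dedekind sums on the right has index $\leq \|S\|$.
   Context: Dedekind sums $S(L,\sigma,e,v)=\sum'_{x\in L}\mathbf{e}(\langle x,v\rangle)\det\sigma/\prod_j\langle x,\sigma_j\rangle^{e_j}$ (prime: omit terms with vanishing denominator; conditionally convergent sums evaluated by a $Q$-limit), abbreviated $S(L,\sigma)$ when $e=(1,\dots,1)$ and $v$ fixed. $Z^k$ is the span of the first $k$ standard basis vectors; $\pi$ projects onto the first $\ell$ coordinates. Properly embedded: $e=(1,\dots,1)$. Normalized: $L=Z^\ell$, each column restricted to $Z^\ell$ primitive integral, columns inducing proportional forms on $Z^\ell$ induce equal forms and are adjacent. Index $\|S\|=\max_I|\det(\pi(\sigma_{i_1}),\dots,\pi(\sigma_{i_\ell}))|$ over $\ell$-subsets $I$. Grouping columns by equal $\pi(\sigma_i)$ gives $s$ classes; $S$ is diagonal if $s=\ell$. *)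

theory Defs
  imports "Jordan_Normal_Form.Determinant" "HOL-Analysis.Infinite_Sum"
begin

no_notation fps_nth (infixl "$" 75)

definition Z_span :: "nat \<Rightarrow> nat \<Rightarrow> real vec set" where
  "Z_span n k = {x \<in> carrier_vec n. (\<forall>i<n. x $ i \<in> \<int>) \<and> (\<forall>i<n. k \<le> i \<longrightarrow> x $ i = 0)}"

definition dedekind_denom :: "real mat \<Rightarrow> (nat \<Rightarrow> nat) \<Rightarrow> real vec \<Rightarrow> real" where
  "dedekind_denom \<sigma> e x = (\<Prod>j<dim_col \<sigma>. (x \<bullet> col \<sigma> j) ^ e j)"

definition dedekind_term ::
  "real mat \<Rightarrow> (nat \<Rightarrow> nat) \<Rightarrow> real vec \<Rightarrow> real vec \<Rightarrow> complex" where
  "dedekind_term \<sigma> e v x =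
     exp (2 * of_real pi * \<i> * of_real (x \<bullet> v)) * of_real (det \<sigma>) / of_real (dedekind_denom \<sigma> e x)"

text \<open>
  A list \<open>Q\<close> of vectors stands for the product of the linear forms they define.  The
  \<open>Q\<close>-limit of a series over a lattice is the limit, as \<open>t\<close> tends to infinity, of the sums
  over the lattice points with \<open>\<bar>Q x\<bar> < t\<close>.  These points need not be finite in number, so
  the truncated sums are themselves (absolutely convergent) infinite sums.
\<close>

definition form_prod :: "real vec list \<Rightarrow> real vec \<Rightarrow> real" where
  "form_prod Q x = (\<Prod>q\<leftarrow>Q. x \<bullet> q)"

definition Q_forms :: "nat \<Rightarrow> real vec list \<Rightarrow> bool" where
  "Q_forms n Q \<longleftrightarrow> Q \<noteq> [] \<and>
     (\<forall>q\<in>set Q. q \<in> carrier_vec n \<and>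
        (\<forall>x\<in>carrier_vec n. (\<forall>i<n. x $ i \<in> \<rat>) \<and> x \<noteq> 0\<^sub>v n \<longrightarrow> x \<bullet> q \<noteq> 0))"

definition truncated_support ::
  "real vec set \<Rightarrow> real mat \<Rightarrow> (nat \<Rightarrow> nat) \<Rightarrow> real vec list \<Rightarrow> real \<Rightarrow> real vec set" where
  "truncated_support L \<sigma> e Q t =
     {x \<in> L. dedekind_denom \<sigma> e x \<noteq> 0 \<and> \<bar>form_prod Q x\<bar> < t}"

definition truncated_dedekind_sum ::
  "real vec set \<Rightarrow> real mat \<Rightarrow> (nat \<Rightarrow> nat) \<Rightarrow> real vec \<Rightarrow> real vec list \<Rightarrow> real \<Rightarrow> complex" where
  "truncated_dedekind_sum L \<sigma> e v Q t =
     (\<Sum>\<^sub>\<infinity>x\<in>truncated_support L \<sigma> e Q t. dedekind_term \<sigma> e v x)"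

definition dedekind_sum ::
  "real vec set \<Rightarrow> real mat \<Rightarrow> (nat \<Rightarrow> nat) \<Rightarrow> real vec \<Rightarrow> real vec list \<Rightarrow> complex" where
  "dedekind_sum L \<sigma> e v Q = Lim at_top (truncated_dedekind_sum L \<sigma> e v Q)"

definition dedekind_sum_converges ::
  "real vec set \<Rightarrow> real mat \<Rightarrow> (nat \<Rightarrow> nat) \<Rightarrow> real vec \<Rightarrow> real vec list \<Rightarrow> bool" where
  "dedekind_sum_converges L \<sigma> e v Q \<longleftrightarrow>
     (\<forall>t. dedekind_term \<sigma> e v summable_on truncated_support L \<sigma> e Q t) \<and>
     (\<exists>s. (truncated_dedekind_sum L \<sigma> e v Q \<longlongrightarrow> s) at_top)"

text \<open>
  The convention under which Dedekind sums are written at all: the \<open>Q\<close>-limit evaluates every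
  sum with unit exponents over a subgroup of the integer lattice on which all columns are
  integral.  By a theorem of Sczech this holds for every \<open>Q\<close> with \<open>Q_forms n Q\<close>.
\<close>

definition Q_limits_exist :: "nat \<Rightarrow> real vec list \<Rightarrow> bool" where
  "Q_limits_exist n Q \<longleftrightarrow>
     (\<forall>L \<sigma> v. L \<subseteq> Z_span n n \<and> 0\<^sub>v n \<in> L \<and> (\<forall>x\<in>L. \<forall>y\<in>L. x - y \<in> L) \<and>
        \<sigma> \<in> carrier_mat n n \<and> (\<forall>x\<in>L. \<forall>j<n. x \<bullet> col \<sigma> j \<in> \<int>) \<and> v \<in> carrier_vec n \<longrightarrow>
        dedekind_sum_converges L \<sigma> (\<lambda>_. 1) v Q)"

definition properly_embedded :: "nat \<Rightarrow> (nat \<Rightarrow> nat) \<Rightarrow> bool" where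
  "properly_embedded n e \<longleftrightarrow> (\<forall>j<n. e j = 1)"

text \<open>
  The form induced by the \<open>j\<close>-th column on the span of the first \<open>l\<close> basis vectors is given
  by the first \<open>l\<close> entries of that column.
\<close>

definition proj_col :: "nat \<Rightarrow> real mat \<Rightarrow> nat \<Rightarrow> real vec" where
  "proj_col l \<sigma> j = vec_first (col \<sigma> j) l"

definition primitive_integral :: "real vec \<Rightarrow> bool" where
  "primitive_integral w \<longleftrightarrow> (\<exists>u::int vec. w = map_vec of_int u \<and> Gcd (vec_set u) = 1)"

definition normalized :: "nat \<Rightarrow> nat \<Rightarrow> real vec set \<Rightarrow> real mat \<Rightarrow> bool" where
  "normalized n l L \<sigma> \<longleftrightarrow>
     L = Z_span n l \<and>
     (\<forall>j<n. primitive_integral (proj_col l \<sigma> j)) \<and>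
     (\<forall>i<n. \<forall>j<n. (\<exists>c. proj_col l \<sigma> i = c \<cdot>\<^sub>v proj_col l \<sigma> j) \<longrightarrow> proj_col l \<sigma> i = proj_col l \<sigma> j) \<and>
     (\<forall>i j k. i < j \<and> j < k \<and> k < n \<and> proj_col l \<sigma> i = proj_col l \<sigma> k \<longrightarrow>
        proj_col l \<sigma> j = proj_col l \<sigma> i)"

definition dedekind_index :: "nat \<Rightarrow> nat \<Rightarrow> real mat \<Rightarrow> real" where
  "dedekind_index n l \<sigma> =
     Max {\<bar>det (mat_of_cols l (map (proj_col l \<sigma>) (sorted_list_of_set I)))\<bar> | I.
          I \<subseteq> {..<n} \<and> card I = l}"

definition diagonal :: "nat \<Rightarrow> nat \<Rightarrow> real mat \<Rightarrow> bool" where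
  "diagonal n l \<sigma> \<longleftrightarrow> card (proj_col l \<sigma> ` {..<n}) = l"

text \<open>
  Integral coordinate changes preserving the lattice of rank \<open>l\<close>.  They identify the standard
  lattice of rank \<open>l - 1\<close> with an arbitrary corank-one direct summand of it.
\<close>

definition coord_change :: "nat \<Rightarrow> nat \<Rightarrow> real mat \<Rightarrow> bool" where
  "coord_change n l \<gamma> \<longleftrightarrow>
     \<gamma> \<in> carrier_mat n n \<and> (\<forall>i<n. \<forall>j<n. \<gamma> $$ (i, j) \<in> \<int>) \<and> \<bar>det \<gamma>\<bar> = 1 \<and>
     (\<lambda>x. \<gamma> *\<^sub>v x) ` Z_span n l = Z_span n l"

text \<open>
  A Dedekind sum read in the coordinates given by \<open>\<gamma>\<close>: substituting \<open>\<gamma> y\<close> for \<open>x\<close> pulls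
  the character and the truncating forms back along the transpose of \<open>\<gamma>\<close>.
\<close>

definition dedekind_sum_in ::
  "real mat \<Rightarrow> real vec set \<Rightarrow> real mat \<Rightarrow> (nat \<Rightarrow> nat) \<Rightarrow> real vec \<Rightarrow> real vec list \<Rightarrow> complex" where
  "dedekind_sum_in \<gamma> L \<tau> e v Q =
     dedekind_sum L \<tau> e (transpose_mat \<gamma> *\<^sub>v v) (map (\<lambda>q. transpose_mat \<gamma> *\<^sub>v q) Q)"

end

theory Submission
  imports Defs
begin

text \<open>
  On the lattice of rank \<open>l\<close> a term of the sum depends only on the determinant and on the multiset of
  forms induced by the columns.  If these forms are linearly dependent, say \<open>p\<^sub>0 = \<Sum> a\<^sub>i p\<^sub>i\<close> with
  rational \<open>a\<^sub>i\<close>, multiplying the term by \<open>1 = \<Sum> a\<^sub>i p\<^sub>i / p\<^sub>0\<close> trades one copy of \<open>p\<^sub>i\<close> for a further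
  copy of \<open>p\<^sub>0\<close>.  This uses no new forms, so the index does not grow, and it is repeated until only
  independent forms remain.  When the last copy of \<open>p\<^sub>i\<close> disappears, the new sum also runs over the
  hyperplane \<open>p\<^sub>i = 0\<close>; the excess is a sum of rank \<open>l - 1\<close>.  There the remaining forms are divided by
  their contents, and a minor of the restricted forms divides the minor of the original forms
  extended by \<open>p\<^sub>i\<close>, which bounds its index.
\<close>

subsection \<open>Determinants and nondegenerate sets of forms\<close>

text \<open>The sums converge only conditionally, so a termwise identity may be summed only if each
  of its parts has a \<open>Q\<close>-limit of its own. All intermediate summands are therefore
  functions on the one lattice \<open>Z_span n l\<close>, and the convergence of each part is
  obtained by realizing it as a rational multiple of a genuine Dedekind sum over a subgroup; this is
  where \<open>Q_limits_exist\<close> enters. It covers arbitrary subgroups, hence also the part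
  lying on a hyperplane, before that part is recognized as a sum of lower rank. The other obstacle
  is the determinant. Every term carries the factor \<open>det \<sigma>\<close>, and after an
  exchange of forms some matrix with the new columns has to reproduce it up to a rational factor.
  This is possible only while the remaining forms still span the space, so spanning is an invariant
  of the whole reduction. It also makes the end point diagonal: independent forms that span are
  exactly \<open>l\<close> in number. Division by the form on the left of a linear relation is
  harmless: that form already occurs in the term, so its zeros are omitted anyway.\<close>

definition nondegenerate :: "nat \<Rightarrow> real vec set \<Rightarrow> bool" where
  "nondegenerate k A \<longleftrightarrow> (\<forall>x\<in>carrier_vec k. (\<forall>p\<in>A. x \<bullet> p = 0) \<longrightarrow> x = 0\<^sub>v k)"

definition integral_vec :: "real vec \<Rightarrow> bool" where
  "integral_vec w \<longleftrightarrow> (\<forall>i<dim_vec w. w $ i \<in> \<int>)"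

lemma nondegenerateD:
  "nondegenerate k A \<Longrightarrow> x \<in> carrier_vec k \<Longrightarrow> (\<And>p. p \<in> A \<Longrightarrow> x \<bullet> p = 0) \<Longrightarrow> x = 0\<^sub>v k"
  unfolding nondegenerate_def by blast

lemma integral_vec_list_nth:
  assumes "set us \<subseteq> carrier_vec k" "\<And>u. u \<in> set us \<Longrightarrow> integral_vec u" "j < length us" "i < k"
  shows "us ! j $ i \<in> \<int>"
proof -
  have j: "us ! j \<in> set us" using assms(3) by simp
  then have "dim_vec (us ! j) = k" using assms(1) by auto
  then show ?thesis using assms(2)[OF j] assms(4) unfolding integral_vec_def by simp
qed

lemma det_permute_columns:
  fixes A :: "'a :: comm_ring_1 mat"
  assumes A: "A \<in> carrier_mat n n" and p: "p permutes {0..<n}"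
  shows "det (mat n n (\<lambda>(i,j). A $$ (i, p j))) = signof p * det A"
proof -
  have pn: "p j < n" if "j < n" for j
    using permutes_in_image[OF p, of j] that by simp
  have "mat n n (\<lambda>(i,j). A $$ (i, p j)) =
      transpose_mat (mat n n (\<lambda>(i,j). transpose_mat A $$ (p i, j)))"
    using A pn by (intro eq_matI) auto
  then have "det (mat n n (\<lambda>(i,j). A $$ (i, p j))) =
      det (mat n n (\<lambda>(i,j). transpose_mat A $$ (p i, j)))"
    by (metis det_transpose mat_carrier)
  also have "\<dots> = signof p * det (transpose_mat A)"
    using A p by (intro det_permute_rows) auto
  finally show ?thesis using det_transpose[OF A] by simp
qed

lemma abs_signof [simp]: "\<bar>signof p\<bar> = (1 :: real)"
  by (simp add: sign_def)

text \<open>A permutation of the columns costs only a sign. Since the index is built from absolute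
  values, its minors depend only on multisets of forms.\<close>

lemma abs_det_mat_of_cols_mset_cong:
  fixes xs ys :: "real vec list"
  assumes "mset xs = mset ys" and len: "length ys = k"
  shows "\<bar>det (mat_of_cols k xs)\<bar> = \<bar>det (mat_of_cols k ys)\<bar>"
proof -
  obtain p where p: "p permutes {..<length ys}" and xs: "permute_list p ys = xs"
    using assms(1) by (rule mset_eq_permutation)
  have p': "p permutes {0..<k}" using p len by (simp add: atLeast0LessThan)
  have pn: "p j < k" if "j < k" for j
    using permutes_in_image[OF p', of j] that by simp
  have "mat_of_cols k xs = mat k k (\<lambda>(i,j). mat_of_cols k ys $$ (i, p j))"
    using p len pn unfolding xs[symmetric]
    by (intro eq_matI) (auto simp: mat_of_cols_def permute_list_nth)
  moreover have "mat_of_cols k ys \<in> carrier_mat k k" using len by auto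
  ultimately have "det (mat_of_cols k xs) = signof p * det (mat_of_cols k ys)"
    using det_permute_columns[OF _ p', of "mat_of_cols k ys"] by metis
  then show ?thesis using abs_signof[of p] by (metis abs_mult mult_1)
qed

lemma distinct_if_det_mat_of_cols_nonzero:
  fixes xs :: "real vec list"
  assumes "length xs = k" "set xs \<subseteq> carrier_vec k" "det (mat_of_cols k xs) \<noteq> 0"
  shows "distinct xs"
proof (rule ccontr)
  assume "\<not> distinct xs"
  then obtain i j where ij: "i < k" "j < k" "i \<noteq> j" "xs ! i = xs ! j"
    using assms(1) by (auto simp: distinct_conv_nth)
  have M: "mat_of_cols k xs \<in> carrier_mat k k" using assms(1) by auto
  have "col (mat_of_cols k xs) i = col (mat_of_cols k xs) j"
    using ij assms(1,2) by (subst (1 2) col_mat_of_cols) (auto dest: nth_mem)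
  from det_identical_columns[OF M ij(3,1,2) this] assms(3) show False by simp
qed

lemma det_in_Ints:
  fixes A :: "real mat"
  assumes "A \<in> carrier_mat n n" "\<And>i j. i < n \<Longrightarrow> j < n \<Longrightarrow> A $$ (i,j) \<in> \<int>"
  shows "det A \<in> \<int>"
  unfolding det_def'[OF assms(1)]
proof (intro Ints_sum Ints_mult Ints_prod)
  fix p i assume "p \<in> {p. p permutes {0..<n}}" "i \<in> {0..<n}"
  then show "A $$ (i, p i) \<in> \<int>" using permutes_in_image[of p "{0..<n}" i] by (intro assms(2)) auto
qed (simp add: sign_def)

text \<open>
  Starting from the unit vectors, the columns are exchanged one at a time: by expansion along the
  column to be exchanged, the new determinant is the scalar product of the new column with the
  nonzero vector of cofactors.
\<close>

lemma nondegenerate_obtains_basis: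
  assumes nd: "nondegenerate k A" and A: "A \<subseteq> carrier_vec k"
  obtains ps where "length ps = k" "set ps \<subseteq> A" "det (mat_of_cols k ps) \<noteq> 0"
proof -
  let ?M = "\<lambda>m ps. mat_of_cols k (ps @ map (unit_vec k) [m..<k]) :: real mat"
  have "m \<le> k \<Longrightarrow> \<exists>ps. length ps = m \<and> set ps \<subseteq> A \<and> det (?M m ps) \<noteq> 0" for m
  proof (induction m)
    case 0
    have "?M 0 [] = 1\<^sub>m k" by (intro eq_matI) (auto simp: mat_of_cols_def unit_vec_def)
    then show ?case by (intro exI[of _ "[]"]) simp
  next
    case (Suc m)
    then obtain ps where ps: "length ps = m" "set ps \<subseteq> A" "det (?M m ps) \<noteq> 0" by auto
    have m: "m < k" using Suc by simp
    have M: "?M m ps \<in> carrier_mat k k" using ps m by auto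
    define y where "y = vec k (\<lambda>i. cofactor (?M m ps) i m)"
    have "y \<noteq> 0\<^sub>v k"
    proof
      assume "y = 0\<^sub>v k"
      then have "cofactor (?M m ps) i m = 0" if "i < k" for i
        using that unfolding y_def by (metis index_vec index_zero_vec(1))
      then have "det (?M m ps) = 0" by (subst laplace_expansion_column[OF M m]) simp
      with ps show False by simp
    qed
    then obtain p where p: "p \<in> A" "y \<bullet> p \<noteq> 0"
      using nondegenerateD[OF nd, of y] unfolding y_def by auto
    let ?M' = "?M (Suc m) (ps @ [p])"
    have M': "?M' \<in> carrier_mat k k" using ps m by auto
    \<comment> \<open>The two matrices differ in column \<open>m\<close> only, and that column is
      deleted here.\<close>
    have cof: "cofactor ?M' i m = cofactor (?M m ps) i m" if "i < k" for i
    proof -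
      have "mat_delete ?M' i m = mat_delete (?M m ps) i m"
        unfolding mat_delete_def using ps m
        by (intro eq_matI) (auto simp: mat_of_cols_def nth_append upt_conv_Cons nth_Cons')
      then show ?thesis by (simp add: cofactor_def)
    qed
    have pc: "p \<in> carrier_vec k" using p A by auto
    have "det ?M' = (\<Sum>i<k. p $ i * y $ i)"
      using m ps cof by (subst laplace_expansion_column[OF M' m])
        (auto simp: y_def mat_of_cols_def nth_append intro!: sum.cong)
    also have "\<dots> = y \<bullet> p"
      using pc by (auto simp: scalar_prod_def atLeast0LessThan mult.commute)
    finally have "det ?M' \<noteq> 0" using p by simp
    then show ?case using ps p by (intro exI[of _ "ps @ [p]"]) auto
  qed
  from this[of k] show ?thesis using that by auto
qed

text \<open>
  For \<open>k < n\<close> the rows below the prescribed ones are free, so that the determinant can be prescribed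
  as well; for \<open>k = n\<close> it is a nonzero integer, and a rational factor has to make up for it.
\<close>

lemma realize_columns_by_matrix:
  assumes len: "length us = n" and us: "set us \<subseteq> carrier_vec k" and kn: "k \<le> n"
    and nd: "nondegenerate k (set us)" and int: "\<And>u. u \<in> set us \<Longrightarrow> integral_vec u"
    and c: "c \<noteq> 0" "k = n \<Longrightarrow> c \<in> \<rat>"
  obtains \<rho> :: "real mat" and q :: rat where "\<rho> \<in> carrier_mat n n"
    "\<And>j. j < n \<Longrightarrow> proj_col k \<rho> j = us ! j" "c = of_rat q * det \<rho>" "k < n \<Longrightarrow> q = 1"
proof -
  obtain ps where ps: "length ps = k" "set ps \<subseteq> set us" "det (mat_of_cols k ps) \<noteq> 0"
    by (rule nondegenerate_obtains_basis[OF nd us])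
  have psc: "set ps \<subseteq> carrier_vec k" using ps us by auto
  \<comment> \<open>The list \<open>us\<close> may repeat vectors; since \<open>ps\<close> does not,
    inclusion of sets lifts to inclusion of multisets, and \<open>ps\<close> can be split off from
    \<open>us\<close>.\<close>
  have "distinct ps" using distinct_if_det_mat_of_cols_nonzero[OF ps(1) psc ps(3)] .
  then have "mset ps = mset_set (set ps)" by (simp add: mset_set_set)
  also have "\<dots> \<subseteq># mset_set (set_mset (mset us))"
    using ps(2) by (intro subset_imp_msubset_mset_set) auto
  also have "\<dots> \<subseteq># mset us" by (rule mset_set_set_mset_msubset)
  finally have "mset ps \<subseteq># mset us" .
  then obtain Z where Z: "mset us = mset ps + Z" by (metis subset_mset.less_eqE)
  obtain zs where "Z = mset zs" by (metis ex_mset)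
  with Z have us_mset: "mset us = mset (ps @ zs)" by simp
  have lz: "length zs = n - k" using arg_cong[OF us_mset, of size] len ps(1) by simp
  show ?thesis
  proof (cases "k < n")
    case False
    then have kn: "k = n" using kn by simp
    let ?\<rho> = "mat_of_cols n us"
    have M: "?\<rho> \<in> carrier_mat n n" using len by auto
    have "mset us = mset ps" using us_mset lz kn by simp
    then have "det ?\<rho> \<noteq> 0"
      using abs_det_mat_of_cols_mset_cong[of us ps k] ps kn by auto
    moreover have "det ?\<rho> \<in> \<int>"
    proof (rule det_in_Ints[OF M])
      fix i j assume "i < n" "j < n"
      then show "?\<rho> $$ (i, j) \<in> \<int>"
        using integral_vec_list_nth[OF us int, of j i] len kn by (simp add: mat_of_cols_def)
    qed
    then have "c / det ?\<rho> \<in> \<rat>" using c(2)[OF kn] by (simp add: Ints_subset_Rats[THEN subsetD])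
    then obtain q where "c / det ?\<rho> = of_rat q" by (rule Rats_cases)
    ultimately have cq: "c = of_rat q * det ?\<rho>" by (simp add: field_simps)
    have "proj_col k ?\<rho> j = us ! j" if "j < n" for j
    proof -
      have "us ! j \<in> carrier_vec n" using that len us kn by auto
      then show ?thesis unfolding proj_col_def using that len kn
        by (intro eq_vecI) (auto simp: vec_first_def)
    qed
    then show ?thesis using False cq by (rule_tac that[OF M, of q]) blast+
  next
    case True
    obtain p where p: "p permutes {..<length (ps @ zs)}" and usp: "permute_list p (ps @ zs) = us"
      using us_mset by (rule mset_eq_permutation)
    have lpz: "length (ps @ zs) = n" using arg_cong[OF us_mset, of size] len by simp
    have p': "p permutes {0..<n}" using p lpz by (simp add: atLeast0LessThan)
    have pn: "p j < n" if "j < n" for j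
      using permutes_in_image[OF p', of j] that by simp
    \<comment> \<open>The block triangular \<open>M\<close> below has determinant
      \<open>det (mat_of_cols k ps) * a\<close>, because \<open>multrow_mat (n-k) 0 a\<close> is the
      identity with one diagonal entry replaced by \<open>a\<close>. The sign of \<open>p\<close> is
      divided out in advance: the columns are permuted back into the order of \<open>us\<close>
      afterwards.\<close>
    define a where "a = c / (signof p * det (mat_of_cols k ps))"
    define M where "M = four_block_mat (mat_of_cols k ps) (mat_of_cols k zs) (0\<^sub>m (n-k) k)
        (multrow_mat (n-k) 0 a)"
    have P: "mat_of_cols k ps \<in> carrier_mat k k" "mat_of_cols k zs \<in> carrier_mat k (n-k)"
      using mat_of_cols_carrier(1)[of k ps] mat_of_cols_carrier(1)[of k zs] ps(1) lz by simp_all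
    have D: "multrow_mat (n-k) 0 a \<in> carrier_mat (n-k) (n-k)" by simp
    have "M \<in> carrier_mat (k + (n-k)) (k + (n-k))"
      unfolding M_def by (rule four_block_carrier_mat[OF P(1) D])
    then have M: "M \<in> carrier_mat n n" using True by simp
    have "det M = det (mat_of_cols k ps) * det (multrow_mat (n-k) 0 a)"
      unfolding M_def by (rule det_four_block_mat_lower_left_zero[OF P refl D])
    then have detM: "det M = det (mat_of_cols k ps) * a"
      using True by (simp add: det_multrow_mat)
    define \<rho> where "\<rho> = mat n n (\<lambda>(i,j). M $$ (i, p j))"
    have sgn: "signof p \<noteq> (0::real)" by (simp add: sign_def)
    have "det \<rho> = signof p * (det (mat_of_cols k ps) * a)"
      unfolding \<rho>_def by (subst det_permute_columns[OF M p']) (simp only: detM)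
    then have "det \<rho> = c" using ps sgn by (simp add: a_def)
    moreover have "proj_col k \<rho> j = us ! j" if j: "j < n" for j
    proof -
      have "us ! j \<in> carrier_vec k" using that len us by auto
      moreover have "us ! j = (ps @ zs) ! p j"
        unfolding usp[symmetric] using p j lpz by (intro permute_list_nth) auto
      ultimately show ?thesis unfolding proj_col_def \<rho>_def using j pn[OF j] True ps(1) lz
        by (intro eq_vecI) (auto simp: vec_first_def M_def mat_of_cols_def nth_append)
    qed
    moreover have "\<rho> \<in> carrier_mat n n" by (simp add: \<rho>_def)
    ultimately show ?thesis using that[of \<rho> 1] by simp
  qed
qed

text \<open>By Cramer's rule each coefficient is a quotient of two determinants of integral
  matrices, hence rational; the adjugate supplies the solution to which the rule is applied. The
  relation is stated through pairings with \<open>x\<close>, the form in which it enters the partial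
  fractions.\<close>

lemma rational_combination_of_basis:
  assumes ps: "length ps = k" "set ps \<subseteq> carrier_vec k" "det (mat_of_cols k ps) \<noteq> 0"
    and int: "\<And>p. p \<in> set ps \<Longrightarrow> integral_vec p"
    and w: "w \<in> carrier_vec k" "integral_vec w"
  obtains a :: "nat \<Rightarrow> rat" where
    "\<And>x. x \<in> carrier_vec k \<Longrightarrow> x \<bullet> w = (\<Sum>i<k. of_rat (a i) * (x \<bullet> ps ! i))"
proof -
  let ?A = "mat_of_cols k ps"
  have A: "?A \<in> carrier_mat k k" using ps by auto
  have entries: "ps ! j $ i \<in> \<int>" if "i < k" "j < k" for i j
    using integral_vec_list_nth[OF ps(2) int] that ps(1) by simp
  define b where "b = (1 / det ?A) \<cdot>\<^sub>v (adj_mat ?A *\<^sub>v w)"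
  have adj: "adj_mat ?A \<in> carrier_mat k k" "?A * adj_mat ?A = det ?A \<cdot>\<^sub>m 1\<^sub>m k"
    using adj_mat[OF A] by auto
  have b: "b \<in> carrier_vec k" unfolding b_def using adj(1) w(1) by auto
  have "?A *\<^sub>v b = (1 / det ?A) \<cdot>\<^sub>v (?A *\<^sub>v (adj_mat ?A *\<^sub>v w))"
    unfolding b_def using A adj(1) w(1) by (intro mult_mat_vec) auto
  also have "?A *\<^sub>v (adj_mat ?A *\<^sub>v w) = (?A * adj_mat ?A) *\<^sub>v w"
    using A adj(1) w(1) by (intro assoc_mult_mat_vec[symmetric]) auto
  also have "\<dots> = det ?A \<cdot>\<^sub>v w"
    unfolding adj(2) using w(1) by (auto intro!: eq_vecI simp: smult_scalar_prod_distrib[of _ k])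
  finally have Ab: "?A *\<^sub>v b = w" using ps(3) w(1) by (auto simp: smult_smult_assoc)
  have "b $ i \<in> \<rat>" if i: "i < k" for i
  proof -
    let ?R = "replace_col ?A w i"
    have "?R \<in> carrier_mat k k" using A by (auto simp: replace_col_def)
    then have "det ?R \<in> \<int>"
      using ps(1) entries w by (intro det_in_Ints)
        (auto simp: replace_col_def mat_of_cols_def integral_vec_def)
    moreover have "det ?A \<in> \<int>"
      using A ps(1) entries by (intro det_in_Ints[OF A]) (auto simp: mat_of_cols_def)
    moreover have "b $ i = det ?R / det ?A"
      using cramer_lemma_mat[OF A b i] ps(3) unfolding Ab by simp
    ultimately show ?thesis by (simp add: Ints_subset_Rats[THEN subsetD])
  qed
  then have "\<exists>r. b $ i = of_rat r" if "i < k" for i using that by (auto simp: Rats_def)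
  then obtain a where a: "\<And>i. i < k \<Longrightarrow> b $ i = of_rat (a i)" by metis
  have "x \<bullet> w = (\<Sum>i<k. of_rat (a i) * (x \<bullet> ps ! i))" if x: "x \<in> carrier_vec k" for x
  proof -
    have "x \<bullet> w = (transpose_mat ?A *\<^sub>v x) \<bullet> b"
      unfolding Ab[symmetric] using transpose_vec_mult_scalar[OF A b x] by simp
    also have "\<dots> = (\<Sum>i<k. (col ?A i \<bullet> x) * b $ i)"
      using A b x by (auto simp: scalar_prod_def[of _ b] atLeast0LessThan ps(1) intro!: sum.cong)
    also have "\<dots> = (\<Sum>i<k. of_rat (a i) * (x \<bullet> ps ! i))"
    proof (intro sum.cong refl)
      fix i assume "i \<in> {..<k}"
      then have i: "i < k" by simp
      then have "ps ! i \<in> carrier_vec k" using ps by auto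
      then show "(col ?A i \<bullet> x) * b $ i = of_rat (a i) * (x \<bullet> ps ! i)"
        using i a ps(1) x by (simp add: comm_scalar_prod[of x k])
    qed
    finally show ?thesis .
  qed
  then show ?thesis by (rule that)
qed

subsection \<open>Unimodular matrices and primitive forms\<close>

definition integral_mat :: "real mat \<Rightarrow> bool" where
  "integral_mat A \<longleftrightarrow> (\<forall>i<dim_row A. \<forall>j<dim_col A. A $$ (i, j) \<in> \<int>)"

text \<open>The integral inverse is part of the notion because the bijectivity of the action on
  integral vectors rests on it.\<close>

definition unimodular :: "nat \<Rightarrow> real mat \<Rightarrow> bool" where
  "unimodular l \<gamma> \<longleftrightarrow> \<gamma> \<in> carrier_mat l l \<and> integral_mat \<gamma> \<and> \<bar>det \<gamma>\<bar> = 1 \<and>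
     (\<exists>\<delta>\<in>carrier_mat l l. integral_mat \<delta> \<and> \<gamma> * \<delta> = 1\<^sub>m l \<and> \<delta> * \<gamma> = 1\<^sub>m l)"

lemma integral_scalar_prod:
  assumes "integral_vec x" "integral_vec y" "dim_vec x = dim_vec y"
  shows "x \<bullet> y \<in> \<int>"
  using assms unfolding scalar_prod_def integral_vec_def by (intro Ints_sum Ints_mult) auto

lemma integral_row: "integral_mat A \<Longrightarrow> i < dim_row A \<Longrightarrow> integral_vec (row A i)"
  unfolding integral_mat_def integral_vec_def by auto

lemma integral_col: "integral_mat A \<Longrightarrow> j < dim_col A \<Longrightarrow> integral_vec (col A j)"
  unfolding integral_mat_def integral_vec_def by auto

lemma integral_mat_mult:
  "integral_mat A \<Longrightarrow> integral_mat B \<Longrightarrow> dim_col A = dim_row B \<Longrightarrow> integral_mat (A * B)"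
  using integral_row integral_col integral_scalar_prod by (auto simp: integral_mat_def[of "A * B"])

lemma integral_mult_mat_vec:
  "integral_mat A \<Longrightarrow> integral_vec x \<Longrightarrow> dim_col A = dim_vec x \<Longrightarrow> integral_vec (A *\<^sub>v x)"
  using integral_row integral_scalar_prod by (auto simp: integral_vec_def[of "A *\<^sub>v x"])

lemma integral_mat_transpose: "integral_mat A \<Longrightarrow> integral_mat (transpose_mat A)"
  unfolding integral_mat_def by auto

lemma unimodular_one: "unimodular l (1\<^sub>m l)"
  unfolding unimodular_def integral_mat_def by (auto intro!: bexI[of _ "1\<^sub>m l"])

lemma unimodular_addrow_mat:
  assumes "k < l" "m < l" "k \<noteq> m" "a \<in> \<int>"
  shows "unimodular l (addrow_mat l a k m)"
proof -
  have "addrow_mat l (- a) k m * addrow_mat l a k m = 1\<^sub>m l"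
    using addrow_mat_inv[OF assms(1-3), of "-a"] by simp
  then show ?thesis
    unfolding unimodular_def integral_mat_def
    using assms det_addrow_mat[OF assms(3), of l a] addrow_mat_inv[OF assms(1-3), of a]
    by (auto intro!: bexI[of _ "addrow_mat l (- a) k m"])
qed

lemma unimodular_mult:
  assumes "unimodular l A" "unimodular l B"
  shows "unimodular l (A * B)"
proof -
  from assms obtain A' B' where A: "A \<in> carrier_mat l l" "integral_mat A" "\<bar>det A\<bar> = 1"
      "A' \<in> carrier_mat l l" "integral_mat A'" "A * A' = 1\<^sub>m l" "A' * A = 1\<^sub>m l"
    and B: "B \<in> carrier_mat l l" "integral_mat B" "\<bar>det B\<bar> = 1"
      "B' \<in> carrier_mat l l" "integral_mat B'" "B * B' = 1\<^sub>m l" "B' * B = 1\<^sub>m l"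
    unfolding unimodular_def by auto
  have "A * B * (B' * A') = A * (B * B') * A'"
    using A(1,4) B(1,4) by (simp add: assoc_mult_mat[of _ l l _ l _ l])
  then have 1: "A * B * (B' * A') = 1\<^sub>m l" using A B by simp
  have "B' * A' * (A * B) = B' * (A' * A) * B"
    using A(1,4) B(1,4) by (simp add: assoc_mult_mat[of _ l l _ l _ l])
  then have 2: "B' * A' * (A * B) = 1\<^sub>m l" using A B by simp
  have 3: "integral_mat (A * B)" "integral_mat (B' * A')"
    using A B by (auto intro!: integral_mat_mult)
  have 4: "\<bar>det (A * B)\<bar> = 1" using A B by (simp add: det_mult[of _ l] abs_mult)
  have "B' * A' \<in> carrier_mat l l" using A B by simp
  with 1 2 3 4 show ?thesis unfolding unimodular_def using A B by auto
qed

lemma transpose_addrow_mat_mult_vec: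
  assumes "k < l" "m < l" "k \<noteq> m" "w \<in> carrier_vec l"
  shows "transpose_mat (addrow_mat l a k m) *\<^sub>v w =
    vec l (\<lambda>j. if j = m then w $ m + a * w $ k else w $ j)"
proof (intro eq_vecI)
  fix j assume "j < dim_vec (vec l (\<lambda>j. if j = m then w $ m + a * w $ k else w $ j))"
  then have j: "j < l" by simp
  have c: "col (addrow_mat l a k m) j = (if j = m then a \<cdot>\<^sub>v unit_vec l k + unit_vec l m else unit_vec l j)"
    using assms j by (auto simp: intro!: eq_vecI)
  show "(transpose_mat (addrow_mat l a k m) *\<^sub>v w) $ j =
      vec l (\<lambda>j. if j = m then w $ m + a * w $ k else w $ j) $ j"
    using j assms c by (auto simp: add_scalar_prod_distrib[of _ l] smult_scalar_prod_distrib[of _ l] add.commute)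
qed simp

text \<open>Euclid's algorithm on the entries of the form, by elementary row operations.\<close>

lemma unimodular_straighten_form:
  assumes l: "1 \<le> l" and w: "w \<in> carrier_vec l" "integral_vec w"
  obtains \<gamma> g where "unimodular l \<gamma>" "transpose_mat \<gamma> *\<^sub>v w = g \<cdot>\<^sub>v unit_vec l (l - 1)"
proof -
  let ?P = "\<lambda>w. \<exists>\<gamma> g. unimodular l \<gamma> \<and> transpose_mat \<gamma> *\<^sub>v w = g \<cdot>\<^sub>v unit_vec l (l - 1)"
  \<comment> \<open>If \<open>\<gamma>\<close> straightens the transformed form, then the elementary
    matrix times \<open>\<gamma>\<close> straightens the original one, since transposition reverses
    products.\<close>
  have step: "?P w" if P: "?P (transpose_mat (addrow_mat l a k m) *\<^sub>v w)"
    and km: "k < l" "m < l" "k \<noteq> m" "a \<in> \<int>" "w \<in> carrier_vec l" for w a k m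
  proof -
    let ?E = "addrow_mat l a k m"
    obtain \<gamma> g where \<gamma>: "unimodular l \<gamma>"
      "transpose_mat \<gamma> *\<^sub>v (transpose_mat ?E *\<^sub>v w) = g \<cdot>\<^sub>v unit_vec l (l - 1)"
      using P by auto
    have \<gamma>c: "\<gamma> \<in> carrier_mat l l" using \<gamma>(1) by (simp add: unimodular_def)
    have "transpose_mat (?E * \<gamma>) *\<^sub>v w = transpose_mat \<gamma> *\<^sub>v (transpose_mat ?E *\<^sub>v w)"
      using \<gamma>c km(5) by (simp add: transpose_mult[of _ l l _ l] assoc_mult_mat_vec[of _ l l _ l])
    then show ?thesis
      using \<gamma> unimodular_mult[OF unimodular_addrow_mat[OF km(1-4)] \<gamma>(1)] by metis
  qed
  let ?\<mu> = "\<lambda>w. \<Sum>i<l. nat \<lfloor>\<bar>w $ i\<bar>\<rfloor>"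
  have "?P w" using w
  proof (induction "?\<mu> w" arbitrary: w rule: less_induct)
    case less
    have int: "w $ i \<in> \<int>" if "i < l" for i using less.prems that by (auto simp: integral_vec_def)
    show ?case
    proof (cases "\<exists>k<l. \<exists>m<l. k \<noteq> m \<and> w $ k \<noteq> 0 \<and> w $ m \<noteq> 0")
      case True
      then obtain k m where km: "k < l" "m < l" "k \<noteq> m" "w $ k \<noteq> 0" "w $ m \<noteq> 0" "\<bar>w $ k\<bar> \<le> \<bar>w $ m\<bar>"
        by (metis linear)
      \<comment> \<open>Subtractive Euclid: with this sign the new entry at \<open>m\<close> has
        absolute value \<open>\<bar>w $ m\<bar> - \<bar>w $ k\<bar>\<close>, so the measure
        \<open>?\<mu>\<close> drops.\<close>
      define a where "a = - sgn (w $ k) * sgn (w $ m)"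
      have a: "a \<in> \<int>" unfolding a_def by (simp add: sgn_if)
      define w' where "w' = transpose_mat (addrow_mat l a k m) *\<^sub>v w"
      have w': "w' = vec l (\<lambda>j. if j = m then w $ m + a * w $ k else w $ j)"
        unfolding w'_def using km less.prems by (intro transpose_addrow_mat_mult_vec) auto
      have int': "integral_vec w'" unfolding w' integral_vec_def using int a km by auto
      have "\<bar>w' $ m\<bar> = \<bar>w $ m\<bar> - \<bar>w $ k\<bar>"
        using km unfolding w' a_def by (auto simp: sgn_if abs_if split: if_splits)
      then have lt: "\<bar>w' $ m\<bar> < \<bar>w $ m\<bar>" using km by simp
      have "\<bar>w $ m\<bar> \<in> \<int>" "\<bar>w' $ m\<bar> \<in> \<int>" using int int' km by (auto simp: integral_vec_def w')
      then have "nat \<lfloor>\<bar>w' $ m\<bar>\<rfloor> < nat \<lfloor>\<bar>w $ m\<bar>\<rfloor>"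
        using lt by (auto elim!: Ints_cases)
      then have "?\<mu> w' < ?\<mu> w"
        using km by (intro sum_strict_mono_ex1) (auto simp: w')
      then have "?P w'" using int' by (intro less.hyps) (auto simp: w')
      then show ?thesis unfolding w'_def using step km a less.prems by blast
    next
      case False
      show ?thesis
      proof (cases "\<forall>i<l. w $ i \<noteq> 0 \<longrightarrow> i = l - 1")
        case True
        then have "transpose_mat (1\<^sub>m l) *\<^sub>v w = w $ (l - 1) \<cdot>\<^sub>v unit_vec l (l - 1)"
          using less.prems l by (auto simp: unit_vec_def intro!: eq_vecI)
        then show ?thesis using unimodular_one by blast
      next
        case False': False
        then obtain i where i: "i < l" "w $ i \<noteq> 0" "i \<noteq> l - 1" by auto
        have z: "w $ j = 0" if "j < l" "j \<noteq> i" for j using False i that by blast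
        \<comment> \<open>Only the entry at \<open>i\<close> survives, but in the wrong place. It is
          copied into the last position, and the copy is then subtracted from the original.\<close>
        let ?w1 = "transpose_mat (addrow_mat l 1 i (l - 1)) *\<^sub>v w"
        let ?w2 = "transpose_mat (addrow_mat l (-1) (l - 1) i) *\<^sub>v ?w1"
        have w1: "?w1 = vec l (\<lambda>j. if j = l - 1 then w $ (l - 1) + 1 * w $ i else w $ j)"
          using i less.prems l by (intro transpose_addrow_mat_mult_vec) auto
        have "?w2 = vec l (\<lambda>j. if j = i then ?w1 $ i + (-1) * ?w1 $ (l - 1) else ?w1 $ j)"
          using i l w1 by (intro transpose_addrow_mat_mult_vec) auto
        then have w2: "?w2 = w $ i \<cdot>\<^sub>v unit_vec l (l - 1)"
          unfolding w1 using i l z by (auto simp: unit_vec_def intro!: eq_vecI)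
        have "transpose_mat (1\<^sub>m l) *\<^sub>v ?w2 = w $ i \<cdot>\<^sub>v unit_vec l (l - 1)"
          unfolding w2 by simp
        then have "?P ?w2" using unimodular_one by blast
        then have "?P ?w1" using i l w1 by (intro step[of "-1" "l - 1" i ?w1]) auto
        then show ?thesis using i l less.prems by (intro step[of 1 i "l - 1" w]) auto
      qed
    qed
  qed
  then show ?thesis using that by blast
qed

lemma unimodular_transpose_cancel:
  assumes "unimodular l \<gamma>" "x \<in> carrier_vec l" "y \<in> carrier_vec l"
    "transpose_mat \<gamma> *\<^sub>v x = transpose_mat \<gamma> *\<^sub>v y"
  shows "x = y"
proof -
  obtain \<delta> where \<delta>: "\<gamma> \<in> carrier_mat l l" "\<delta> \<in> carrier_mat l l" "\<gamma> * \<delta> = 1\<^sub>m l"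
    using assms(1) unfolding unimodular_def by auto
  have "transpose_mat \<delta> * transpose_mat \<gamma> = 1\<^sub>m l"
    using \<delta> by (metis transpose_mult transpose_one)
  then have "transpose_mat \<delta> *\<^sub>v (transpose_mat \<gamma> *\<^sub>v z) = z" if "z \<in> carrier_vec l" for z
    using that \<delta> by (metis assoc_mult_mat_vec one_mult_mat_vec transpose_carrier_mat)
  then show ?thesis using assms by metis
qed

section \<open>Primitive forms and contents\<close>

lemma primitive_integral_imp_integral: "primitive_integral w \<Longrightarrow> integral_vec w"
  unfolding primitive_integral_def integral_vec_def by auto

lemma primitive_integral_nonzero: "primitive_integral z \<Longrightarrow> z \<noteq> 0\<^sub>v k"
proof
  assume "primitive_integral z" "z = 0\<^sub>v k"
  then obtain u :: "int vec" where u: "0\<^sub>v k = map_vec real_of_int u" "Gcd (vec_set u) = 1"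
    unfolding primitive_integral_def by auto
  have "u $ i = 0" if "i < dim_vec u" for i
    using arg_cong[OF u(1), of "\<lambda>v. v $ i"] arg_cong[OF u(1), of dim_vec] that by simp
  then have "vec_set u \<subseteq> {0}" unfolding vec_set_def by auto
  then have "Gcd (vec_set u) = 0" by (simp add: Gcd_0_iff)
  with u show False by simp
qed

text \<open>Straightening turns \<open>z\<close> into \<open>g\<close> times the last unit vector.
  Undoing it shows that \<open>g\<close> divides every entry of \<open>z\<close>, so
  \<open>g\<close> is 1 or -1 by primitivity. The straightened multiple of \<open>z\<close> is still
  integral and has last entry \<open>d * g\<close>, so \<open>d\<close> is integral.\<close>

lemma primitive_multiple_integral:
  assumes z: "primitive_integral z" "z \<in> carrier_vec k" and d: "integral_vec (d \<cdot>\<^sub>v z)"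
  shows "d \<in> \<int>"
proof -
  have "k \<noteq> 0"
  proof
    assume "k = 0"
    then have "z = 0\<^sub>v 0" using z(2) by auto
    then show False using primitive_integral_nonzero[OF z(1)] by blast
  qed
  then have k: "1 \<le> k" by simp
  obtain \<gamma> g where \<gamma>: "unimodular k \<gamma>" "transpose_mat \<gamma> *\<^sub>v z = g \<cdot>\<^sub>v unit_vec k (k - 1)"
    using unimodular_straighten_form[OF k z(2) primitive_integral_imp_integral[OF z(1)]] by blast
  obtain \<delta> where \<delta>: "\<gamma> \<in> carrier_mat k k" "\<delta> \<in> carrier_mat k k" "\<gamma> * \<delta> = 1\<^sub>m k"
      "integral_mat \<gamma>" "integral_mat \<delta>"
    using \<gamma>(1) unfolding unimodular_def by auto
  have "transpose_mat \<delta> * transpose_mat \<gamma> = 1\<^sub>m k"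
    using \<delta> by (metis transpose_mult transpose_one)
  then have "z = transpose_mat \<delta> *\<^sub>v (transpose_mat \<gamma> *\<^sub>v z)"
    using z(2) \<delta> by (metis assoc_mult_mat_vec one_mult_mat_vec transpose_carrier_mat)
  then have zi: "z $ i = g * \<delta> $$ (k - 1, i)" if "i < k" for i
    using that k \<delta> unfolding \<gamma>(2) by (simp add: scalar_prod_right_unit mult_mat_vec[of _ k k])
  have "integral_vec (transpose_mat \<gamma> *\<^sub>v z)"
    using z \<delta> by (intro integral_mult_mat_vec integral_mat_transpose primitive_integral_imp_integral) auto
  then have "g \<in> \<int>" using k unfolding \<gamma>(2) integral_vec_def by (auto dest!: spec[of _ "k - 1"])
  then obtain g' where g': "g = of_int g'" by (auto elim: Ints_cases)
  obtain u :: "int vec" where u: "z = map_vec real_of_int u" "Gcd (vec_set u) = 1"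
    using z(1) unfolding primitive_integral_def by auto
  have "g' dvd u $ i" if "i < k" for i
  proof -
    have "\<delta> $$ (k - 1, i) \<in> \<int>" using \<delta>(2,5) that k unfolding integral_mat_def by auto
    then obtain b where b: "\<delta> $$ (k - 1, i) = of_int b" by (rule Ints_cases)
    have "real_of_int (u $ i) = of_int (g' * b)"
      using zi[OF that] u(1) z(2) that b g' by auto
    then show ?thesis by (metis dvd_triv_left of_int_eq_iff)
  qed
  then have "g' dvd Gcd (vec_set u)"
    using u(1) z(2) unfolding vec_set_def by (intro Gcd_greatest) auto
  then have g1: "\<bar>g'\<bar> = 1" using u(2) by simp
  have "integral_vec (transpose_mat \<gamma> *\<^sub>v (d \<cdot>\<^sub>v z))"
    using z d \<delta> by (intro integral_mult_mat_vec integral_mat_transpose) auto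
  moreover have "transpose_mat \<gamma> *\<^sub>v (d \<cdot>\<^sub>v z) = d \<cdot>\<^sub>v (g \<cdot>\<^sub>v unit_vec k (k - 1))"
    using z \<delta> \<gamma>(2) by (simp add: mult_mat_vec[of _ k k])
  ultimately have "d * g \<in> \<int>" using k unfolding integral_vec_def by (auto dest!: spec[of _ "k - 1"])
  moreover have "g = 1 \<or> g = -1" using g1 g' by auto
  ultimately show ?thesis by (auto simp: minus_in_Ints_iff)
qed

text \<open>
  Choosing among all primitive forms on the same line makes \<open>prim_form\<close> agree on proportional
  forms, including those of opposite sign.
\<close>

definition prim_form :: "real vec \<Rightarrow> real vec" where
  "prim_form w = (SOME z. primitive_integral z \<and> (\<exists>d. w = d \<cdot>\<^sub>v z))"

lemma prim_form_smult:
  assumes "c \<noteq> 0"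
  shows "prim_form (c \<cdot>\<^sub>v w) = prim_form w"
proof -
  have "(\<exists>d. c \<cdot>\<^sub>v w = d \<cdot>\<^sub>v z) = (\<exists>d. w = d \<cdot>\<^sub>v z)" for z
  proof
    assume "\<exists>d. c \<cdot>\<^sub>v w = d \<cdot>\<^sub>v z"
    then obtain d where d: "c \<cdot>\<^sub>v w = d \<cdot>\<^sub>v z" by auto
    have "w = (1 / c) \<cdot>\<^sub>v (c \<cdot>\<^sub>v w)" using assms by (simp add: smult_smult_assoc)
    also have "\<dots> = (d / c) \<cdot>\<^sub>v z" unfolding d by (simp add: smult_smult_assoc)
    finally show "\<exists>d. w = d \<cdot>\<^sub>v z" by blast
  next
    assume "\<exists>d. w = d \<cdot>\<^sub>v z"
    then obtain d where "w = d \<cdot>\<^sub>v z" by auto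
    then have "c \<cdot>\<^sub>v w = (c * d) \<cdot>\<^sub>v z" by (simp add: smult_smult_assoc)
    then show "\<exists>d. c \<cdot>\<^sub>v w = d \<cdot>\<^sub>v z" by blast
  qed
  then show ?thesis unfolding prim_form_def by simp
qed

lemma ex_primitive_multiple:
  assumes w: "w \<in> carrier_vec k" "integral_vec w" "w \<noteq> 0\<^sub>v k"
  shows "\<exists>z. primitive_integral z \<and> (\<exists>d. w = d \<cdot>\<^sub>v z)"
proof -
  define u where "u = vec k (\<lambda>i. \<lfloor>w $ i\<rfloor>)"
  have wu: "w $ i = of_int (u $ i)" if "i < k" for i
    using w(1,2) that unfolding u_def integral_vec_def by auto
  define g where "g = Gcd (vec_set u)"
  have "\<exists>i<k. w $ i \<noteq> 0"
    using w(1,3) by (metis eq_vecI carrier_vecD index_zero_vec)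
  then have "g \<noteq> 0" using wu unfolding g_def Gcd_0_iff vec_set_def u_def by fastforce
  define z where "z = vec k (\<lambda>i. u $ i div g)"
  have ug: "u $ i = g * z $ i" if "i < k" for i
  proof -
    have "g dvd u $ i" unfolding g_def vec_set_def using that by (intro Gcd_dvd) (auto simp: u_def)
    then show ?thesis using that by (simp add: z_def)
  qed
  have "vec_set u = (*) g ` vec_set z"
    unfolding vec_set_def image_image using ug by (intro image_cong) (auto simp: u_def z_def)
  then have "g = normalize (g * Gcd (vec_set z))"
    using g_def by (metis Gcd_mult)
  then have "\<bar>g\<bar> = \<bar>g\<bar> * \<bar>Gcd (vec_set z)\<bar>" by (metis abs_abs abs_mult normalize_int_def)
  then have "Gcd (vec_set z) = 1" using \<open>g \<noteq> 0\<close> by simp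
  then have "primitive_integral (map_vec of_int z)" unfolding primitive_integral_def by blast
  moreover have "w = of_int g \<cdot>\<^sub>v map_vec of_int z"
  proof (intro eq_vecI)
    have dz: "dim_vec z = k" by (simp add: z_def)
    then show "dim_vec w = dim_vec (of_int g \<cdot>\<^sub>v map_vec of_int z)" using w(1) by simp
    fix i assume "i < dim_vec (real_of_int g \<cdot>\<^sub>v map_vec of_int z)"
    then show "w $ i = (of_int g \<cdot>\<^sub>v map_vec of_int z) $ i" using wu ug[of i] dz by simp
  qed
  ultimately show ?thesis by blast
qed

text \<open>The chosen form is only known to lie on the line of \<open>w\<close>. That the factor
  \<open>d\<close> is an integer comes from \<open>primitive_multiple_integral\<close>, and being
  nonzero it has absolute value at least 1; this bound keeps the index from growing when contents
  are divided out.\<close>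

lemma prim_form_props:
  assumes w: "w \<in> carrier_vec k" "integral_vec w" "w \<noteq> 0\<^sub>v k"
  shows "primitive_integral (prim_form w)" "prim_form w \<in> carrier_vec k"
    "\<exists>d. \<bar>d\<bar> \<ge> 1 \<and> w = d \<cdot>\<^sub>v prim_form w"
proof -
  have *: "primitive_integral (prim_form w) \<and> (\<exists>d. w = d \<cdot>\<^sub>v prim_form w)"
    unfolding prim_form_def by (rule someI_ex[OF ex_primitive_multiple[OF w]])
  then show "primitive_integral (prim_form w)" by simp
  obtain d where d: "w = d \<cdot>\<^sub>v prim_form w" using * by auto
  show c: "prim_form w \<in> carrier_vec k" using arg_cong[OF d, of dim_vec] w(1) by auto
  have "d \<in> \<int>" using primitive_multiple_integral[of "prim_form w" k d] * c d w(2) by simp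
  moreover have "d \<noteq> 0"
  proof
    assume "d = 0"
    then have "w = 0\<^sub>v k" using d c by (metis carrier_vecD eq_vecI index_smult_vec index_zero_vec mult_zero_left)
    with w(3) show False by simp
  qed
  ultimately have "\<bar>d\<bar> \<ge> 1" by (auto elim!: Ints_cases)
  with d show "\<exists>d. \<bar>d\<bar> \<ge> 1 \<and> w = d \<cdot>\<^sub>v prim_form w" by blast
qed

section \<open>Determinants under scaling and restriction of forms\<close>

lemma det_mat_of_cols_smult:
  fixes us :: "real vec list" and f :: "real vec \<Rightarrow> real vec"
  assumes "length us = k" "\<And>u. u \<in> set us \<Longrightarrow> f u \<in> carrier_vec k"
  shows "det (mat_of_cols k (map (\<lambda>u. d u \<cdot>\<^sub>v f u) us)) =
    (\<Prod>i=0..<k. d (us ! i)) * det (mat_of_cols k (map f us))"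
proof -
  have T: "det (mat_of_cols k (map h us)) = det (mat\<^sub>r k k (\<lambda>i. h (us ! i)))"
    if "\<And>u. u \<in> set us \<Longrightarrow> h u \<in> carrier_vec k" for h :: "real vec \<Rightarrow> real vec"
  proof -
    have M: "mat_of_cols k (map h us) \<in> carrier_mat k k"
      using mat_of_cols_carrier(1)[of k "map h us"] assms(1) by simp
    have "transpose_mat (mat_of_cols k (map h us)) = mat\<^sub>r k k (\<lambda>i. h (us ! i))"
      using assms(1) that by (intro eq_matI) (auto simp: mat_of_cols_def)
    then show ?thesis using det_transpose[OF M] by simp
  qed
  have "det (mat_of_cols k (map (\<lambda>u. d u \<cdot>\<^sub>v f u) us)) =
      det (mat\<^sub>r k k (\<lambda>i. d (us ! i) \<cdot>\<^sub>v f (us ! i)))"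
    using assms(2) by (intro T) auto
  also have "\<dots> = (\<Prod>i=0..<k. d (us ! i)) * det (mat\<^sub>r k k (\<lambda>i. f (us ! i)))"
    using assms by (intro det_rows_mul) auto
  also have "det (mat\<^sub>r k k (\<lambda>i. f (us ! i))) = det (mat_of_cols k (map f us))"
    using assms(2) by (intro T[symmetric]) auto
  finally show ?thesis .
qed

text \<open>Multiplication by the transpose of \<open>\<gamma>\<close> changes at most the sign of
  the determinant and turns the last column into \<open>g\<close> times the last unit vector. The
  product is then block lower triangular, with the restricted forms in one diagonal block and
  \<open>g\<close> in the other.\<close>

lemma det_restrict_to_hyperplane:
  assumes l: "1 \<le> l" and \<gamma>: "unimodular l \<gamma>" and p: "p \<in> carrier_vec l"
    and g: "transpose_mat \<gamma> *\<^sub>v p = g \<cdot>\<^sub>v unit_vec l (l - 1)"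
    and rs: "length rs = l - 1" "set rs \<subseteq> carrier_vec l"
  shows "\<bar>det (mat_of_cols l (rs @ [p]))\<bar> =
    \<bar>det (mat_of_cols (l - 1) (map (\<lambda>r. vec_first (transpose_mat \<gamma> *\<^sub>v r) (l - 1)) rs))\<bar> * \<bar>g\<bar>"
proof -
  let ?f = "\<lambda>r. vec_first (transpose_mat \<gamma> *\<^sub>v r) (l - 1)"
  let ?M = "mat_of_cols l (rs @ [p])"
  have \<gamma>c: "\<gamma> \<in> carrier_mat l l" "\<bar>det \<gamma>\<bar> = 1" using \<gamma> by (auto simp: unimodular_def)
  have M: "?M \<in> carrier_mat l l"
    using mat_of_cols_carrier(1)[of l "rs @ [p]"] rs(1) l by simp
  let ?A = "mat_of_cols (l - 1) (map ?f rs)"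
  let ?X = "mat 1 (l - 1) (\<lambda>(i,j). (transpose_mat \<gamma> *\<^sub>v (rs ! j)) $ (l - 1))"
  let ?G = "mat 1 1 (\<lambda>_. g)"
  have A: "?A \<in> carrier_mat (l - 1) (l - 1)"
    using mat_of_cols_carrier(1)[of "l - 1" "map ?f rs"] rs(1) by simp
  have entry: "(transpose_mat \<gamma> * ?M) $$ (i, j) = (transpose_mat \<gamma> *\<^sub>v ((rs @ [p]) ! j)) $ i"
    if "i < l" "j < l" for i j
  proof -
    have "(rs @ [p]) ! j \<in> carrier_vec l"
      using that rs p by (auto simp: nth_append subset_iff)
    then show ?thesis using that \<gamma>c M rs l by simp
  qed
  have "transpose_mat \<gamma> * ?M = four_block_mat ?A (0\<^sub>m (l - 1) 1) ?X ?G" (is "_ = ?B")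
  proof (rule eq_matI)
    fix i j assume "i < dim_row ?B" "j < dim_col ?B"
    then have ij: "i < l" "j < l" using l rs(1) by auto
    show "(transpose_mat \<gamma> * ?M) $$ (i, j) = ?B $$ (i, j)"
      unfolding entry[OF ij] using ij l rs(1) g
      by (auto simp: nth_append mat_of_cols_def vec_first_def less_Suc_eq_le intro!: arg_cong[of _ _ "\<lambda>i. _ $ i"])
  qed (use \<gamma>c M l rs in auto)
  then have "det (transpose_mat \<gamma> * ?M) = det ?A * det ?G"
    using det_four_block_mat_upper_right_zero[OF A refl, of ?X 1 ?G] by simp
  moreover have "det ?G = g" by (subst det_single) auto
  moreover have "det (transpose_mat \<gamma> * ?M) = det \<gamma> * det ?M"
    using \<gamma>c M by (simp add: det_mult[of _ l] det_transpose)
  ultimately have "\<bar>det \<gamma> * det ?M\<bar> = \<bar>det ?A * g\<bar>" by simp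
  then show ?thesis using \<gamma>c(2) by (simp add: abs_mult)
qed

subsection \<open>Lattices, indices and Q-limits\<close>

lemma scalar_prod_vec_first:
  fixes x :: "'a :: comm_semiring_0 vec"
  assumes "x \<in> carrier_vec n" "y \<in> carrier_vec n" "k \<le> n"
    "\<And>i. i < n \<Longrightarrow> k \<le> i \<Longrightarrow> x $ i = 0"
  shows "x \<bullet> y = vec_first x k \<bullet> vec_first y k"
proof -
  have "x \<bullet> y = (\<Sum>i\<in>{0..<n}. x $ i * y $ i)" using assms(2) by (simp add: scalar_prod_def)
  also have "\<dots> = (\<Sum>i\<in>{0..<k}. x $ i * y $ i)"
    using assms(3,4) by (intro sum.mono_neutral_right) auto
  finally show ?thesis by (simp add: scalar_prod_def vec_first_def)
qed

lemma Z_spanD: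
  assumes "x \<in> Z_span n k"
  shows "x \<in> carrier_vec n" "\<And>i. i < n \<Longrightarrow> x $ i \<in> \<int>" "\<And>i. i < n \<Longrightarrow> k \<le> i \<Longrightarrow> x $ i = 0"
  using assms unfolding Z_span_def by auto

lemma Z_span_as_image:
  assumes "k \<le> n"
  shows "Z_span n k = (\<lambda>a. a @\<^sub>v 0\<^sub>v (n - k)) ` {a \<in> carrier_vec k. integral_vec a}"
proof (intro equalityI subsetI)
  fix x assume x: "x \<in> Z_span n k"
  then have "x = vec_first x k @\<^sub>v 0\<^sub>v (n - k)"
    using assms by (intro eq_vecI) (auto simp: vec_first_def Z_span_def)
  moreover have "integral_vec (vec_first x k)"
    using x assms by (auto simp: integral_vec_def vec_first_def Z_span_def)
  ultimately show "x \<in> (\<lambda>a. a @\<^sub>v 0\<^sub>v (n - k)) ` {a \<in> carrier_vec k. integral_vec a}"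
    by (intro image_eqI[of _ _ "vec_first x k"]) auto
next
  fix x assume "x \<in> (\<lambda>a. a @\<^sub>v 0\<^sub>v (n - k)) ` {a \<in> carrier_vec k. integral_vec a}"
  then obtain a where a: "x = a @\<^sub>v 0\<^sub>v (n - k)" "a \<in> carrier_vec k" "integral_vec a" by auto
  have "x \<in> carrier_vec n" using a(1,2) assms by (intro carrier_vecI) simp
  moreover have "x $ i \<in> \<int>" "k \<le> i \<longrightarrow> x $ i = 0" if "i < n" for i
    using a assms that by (auto simp: integral_vec_def)
  ultimately show "x \<in> Z_span n k" unfolding Z_span_def by blast
qed

lemma vec_first_append: "a \<in> carrier_vec k \<Longrightarrow> vec_first (a @\<^sub>v b) k = a"
  by (intro eq_vecI) (auto simp: vec_first_def)

lemma Z_span_subgroup: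
  assumes "x \<in> Z_span n k" "y \<in> Z_span n k"
  shows "x - y \<in> Z_span n k"
  using assms unfolding Z_span_def by auto

section \<open>Arrangement of columns, and the index as a bound on minors\<close>

definition adjacent_classes :: "'a list \<Rightarrow> bool" where
  "adjacent_classes us \<longleftrightarrow>
     (\<forall>i j k. i < j \<and> j < k \<and> k < length us \<and> us ! i = us ! k \<longrightarrow> us ! j = us ! i)"

text \<open>Sorting by an arbitrary injective key works: between two equal keys a sorted list
  contains only that key, and by injectivity only that element.\<close>

lemma ex_adjacent_arrangement: "\<exists>us. mset us = U \<and> adjacent_classes us"
proof -
  obtain xs where xs: "mset xs = U" by (metis ex_mset)
  obtain f :: "'a \<Rightarrow> nat" where f: "inj_on f (set xs)"
    using finite_imp_inj_to_nat_seg[of "set xs"] by auto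
  define us where "us = sort_key f xs"
  have us: "set us = set xs" "mset us = U" unfolding us_def using xs by auto
  have srt: "sorted (map f us)" unfolding us_def by simp
  have "us ! j = us ! i" if ijk: "i < j" "j < k" "k < length us" "us ! i = us ! k" for i j k
  proof -
    have "f (us ! i) \<le> f (us ! j)" "f (us ! j) \<le> f (us ! k)"
      using sorted_nth_mono[OF srt, of i j] sorted_nth_mono[OF srt, of j k] ijk by auto
    then have "f (us ! j) = f (us ! i)" using ijk by simp
    moreover have "us ! i \<in> set xs" "us ! j \<in> set xs"
      using ijk us(1)[symmetric] by auto
    ultimately show ?thesis using f by (auto dest: inj_onD)
  qed
  then show ?thesis using us(2) unfolding adjacent_classes_def by blast
qed

lemma normalizedI:
  assumes "length us = n" "\<And>j. j < n \<Longrightarrow> proj_col k \<rho> j = us ! j" "adjacent_classes us"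
    "\<And>u. u \<in> set us \<Longrightarrow> primitive_integral u"
    "\<And>u w c. u \<in> set us \<Longrightarrow> w \<in> set us \<Longrightarrow> u = c \<cdot>\<^sub>v w \<Longrightarrow> u = w"
  shows "normalized n k (Z_span n k) \<rho>"
  unfolding normalized_def
proof (intro conjI allI impI)
  fix i j assume "i < n" "j < n" "\<exists>c. proj_col k \<rho> i = c \<cdot>\<^sub>v proj_col k \<rho> j"
  then show "proj_col k \<rho> i = proj_col k \<rho> j" using assms(1,2,5) by (metis nth_mem)
next
  fix i j m assume "i < j \<and> j < m \<and> m < n \<and> proj_col k \<rho> i = proj_col k \<rho> m"
  then show "proj_col k \<rho> j = proj_col k \<rho> i"
    using assms(1,2,3) unfolding adjacent_classes_def by (metis less_trans)
qed (use assms in auto)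

text \<open>Together with \<open>dedekind_index_ge\<close> this replaces the maximum over sets of
  column positions by a bound over lists of forms, for which positions and multiplicities of the
  columns no longer matter. Indices of matrices of different shape are then compared by comparing
  their sets of forms.\<close>

lemma dedekind_index_le:
  assumes k: "k \<le> n"
    and b: "\<And>us. length us = k \<Longrightarrow> set us \<subseteq> proj_col k \<rho> ` {..<n} \<Longrightarrow> \<bar>det (mat_of_cols k us)\<bar> \<le> b"
  shows "dedekind_index n k \<rho> \<le> b"
proof -
  let ?S = "{\<bar>det (mat_of_cols k (map (proj_col k \<rho>) (sorted_list_of_set I)))\<bar> | I.
      I \<subseteq> {..<n} \<and> card I = k}"
  have "finite ?S" by (rule finite_subset[OF _ finite_imageI[OF finite_Pow_iff[THEN iffD2,
        OF finite_lessThan[of n]], of "\<lambda>I. \<bar>det (mat_of_cols k (map (proj_col k \<rho>) (sorted_list_of_set I)))\<bar>"]]) auto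
  moreover have "?S \<noteq> {}"
  proof -
    have "{..<k} \<subseteq> {..<n} \<and> card {..<k} = k" using k by auto
    then show ?thesis by blast
  qed
  moreover have "s \<le> b" if s: "s \<in> ?S" for s
  proof -
    obtain I where I: "I \<subseteq> {..<n}" "card I = k"
      "s = \<bar>det (mat_of_cols k (map (proj_col k \<rho>) (sorted_list_of_set I)))\<bar>" using s by auto
    have "finite I" using I(1) finite_subset by blast
    then show ?thesis unfolding I(3) using I(1,2) by (intro b) auto
  qed
  ultimately show ?thesis unfolding dedekind_index_def by (simp add: Max_le_iff)
qed

lemma dedekind_index_ge:
  assumes k: "k \<le> n" and us: "length us = k" "set us \<subseteq> proj_col k \<rho> ` {..<n}"
  shows "\<bar>det (mat_of_cols k us)\<bar> \<le> dedekind_index n k \<rho>"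
proof -
  let ?f = "\<lambda>I. \<bar>det (mat_of_cols k (map (proj_col k \<rho>) (sorted_list_of_set I)))\<bar>"
  let ?S = "{?f I | I. I \<subseteq> {..<n} \<and> card I = k}"
  have fin: "finite ?S" by (rule finite_subset[OF _ finite_imageI[OF finite_Pow_iff[THEN iffD2,
        OF finite_lessThan[of n]], of ?f]]) auto
  have ge: "?f I \<le> dedekind_index n k \<rho>" if "I \<subseteq> {..<n}" "card I = k" for I
    unfolding dedekind_index_def using fin that by (intro Max_ge) auto
  have usc: "set us \<subseteq> carrier_vec k" using us(2) by (auto simp: proj_col_def)
  show ?thesis
  proof (cases "det (mat_of_cols k us) = 0")
    case True
    \<comment> \<open>A vanishing minor only needs the index to be nonnegative, and some set of
      \<open>k\<close> columns exists because \<open>k \<le> n\<close>.\<close>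
    have "{..<k} \<subseteq> {..<n}" using k by auto
    from ge[OF this] True show ?thesis by simp
  next
    case False
    \<comment> \<open>The columns of a nonzero minor are pairwise different, so picking one position
      for each yields a set of exactly \<open>k\<close> positions.\<close>
    then have dist: "distinct us" using distinct_if_det_mat_of_cols_nonzero[OF us(1) usc] by blast
    have "\<forall>u\<in>set us. \<exists>j<n. proj_col k \<rho> j = u" using us(2) by auto
    then obtain h where h: "\<And>u. u \<in> set us \<Longrightarrow> h u < n \<and> proj_col k \<rho> (h u) = u" by metis
    have inj: "inj_on h (set us)" by (metis h inj_onI)
    let ?I = "h ` set us"
    have "map (proj_col k \<rho>) (map h us) = us" using h by (simp add: map_idI)
    moreover have "distinct (map h us)" using dist inj by (simp add: distinct_map)
    then have "mset (sorted_list_of_set ?I) = mset (map h us)"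
      using mset_set_set[of "map h us"] mset_set_set[of "sorted_list_of_set ?I"] by simp
    then have "mset (map (proj_col k \<rho>) (sorted_list_of_set ?I)) = mset (map (proj_col k \<rho>) (map h us))"
      by (metis mset_map)
    ultimately have "?f ?I = \<bar>det (mat_of_cols k us)\<bar>"
      using us(1) by (intro abs_det_mat_of_cols_mset_cong) auto
    moreover have "card ?I = k" using inj dist us(1) by (simp add: card_image distinct_card)
    ultimately show ?thesis using ge[of ?I] h by auto
  qed
qed

text \<open>Since \<open>inverse 0 = 0\<close>, the terms omitted from a Dedekind sum vanish here.\<close>

definition form_term :: "nat \<Rightarrow> real \<Rightarrow> real vec \<Rightarrow> real vec multiset \<Rightarrow> real vec \<Rightarrow> complex" where
  "form_term k c v U x = exp (2 * of_real pi * \<i> * of_real (x \<bullet> v)) *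
     of_real (c * (\<Prod>p\<in>#U. inverse (vec_first x k \<bullet> p)))"

lemma prod_mset_mset_nth: "(\<Prod>p\<in>#mset us. f p) = (\<Prod>j<length us. f (us ! j))"
proof -
  have "(\<Prod>p\<in>#mset us. f p) = prod_list (map f us)"
    by (metis mset_map prod_mset_prod_list)
  also have "\<dots> = (\<Prod>j<length us. f (us ! j))"
    by (simp add: prod.list_conv_set_nth atLeast0LessThan)
  finally show ?thesis .
qed

lemma dedekind_term_conv_form_term:
  assumes \<rho>: "\<rho> \<in> carrier_mat n n" and k: "k \<le> n" and x: "x \<in> Z_span n k"
    and us: "length us = n" "\<And>j. j < n \<Longrightarrow> proj_col k \<rho> j = us ! j"
    and e: "properly_embedded n e"
  shows "dedekind_term \<rho> e v x = form_term k (det \<rho>) v (mset us) x"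
proof -
  have "col \<rho> j \<in> carrier_vec n" for j using \<rho> by (metis col_dim carrier_matD(1))
  then have "x \<bullet> col \<rho> j = vec_first x k \<bullet> us ! j" if "j < n" for j
    using scalar_prod_vec_first[of x n "col \<rho> j" k] Z_spanD[OF x] \<rho> k us(2)[OF that]
    by (simp add: proj_col_def)
  then have "dedekind_denom \<rho> e x = (\<Prod>j<n. vec_first x k \<bullet> us ! j)"
    using \<rho> e by (auto simp: dedekind_denom_def properly_embedded_def intro!: prod.cong)
  then have "inverse (dedekind_denom \<rho> e x) = (\<Prod>p\<in>#mset us. inverse (vec_first x k \<bullet> p))"
    unfolding prod_mset_mset_nth us(1) using prod_inversef[of "\<lambda>j. vec_first x k \<bullet> us ! j"]
    by (simp add: comp_def)
  then show ?thesis
    unfolding dedekind_term_def form_term_def by (simp add: divide_inverse flip: of_real_inverse)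
qed

text \<open>\<open>properly_embedded\<close> fixes \<open>e\<close> only at the column positions,
  whereas \<open>Q_limits_exist\<close> speaks of the constant function 1.\<close>

lemma dedekind_sum_unit_exponents:
  assumes "\<rho> \<in> carrier_mat n n" "properly_embedded n e"
  shows "dedekind_sum L \<rho> e v Q = dedekind_sum L \<rho> (\<lambda>_. 1) v Q"
proof -
  have "dedekind_denom \<rho> e = dedekind_denom \<rho> (\<lambda>_. 1)"
    using assms by (auto simp: dedekind_denom_def properly_embedded_def intro!: ext prod.cong)
  then have "truncated_dedekind_sum L \<rho> e v Q = truncated_dedekind_sum L \<rho> (\<lambda>_. 1) v Q"
    unfolding truncated_dedekind_sum_def truncated_support_def dedekind_term_def by simp
  then show ?thesis unfolding dedekind_sum_def by simp
qed

text \<open>The \<open>Q\<close>-limit of an arbitrary summand over one fixed lattice.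
  \<open>truncated_support\<close> varies with the matrix; here the domain of summation does not, so
  that summands of different matrices and on different sublattices can be combined linearly.\<close>

definition Q_sums :: "real vec set \<Rightarrow> real vec list \<Rightarrow> (real vec \<Rightarrow> complex) \<Rightarrow> complex \<Rightarrow> bool" where
  "Q_sums L Q F s \<longleftrightarrow> (\<forall>t. F summable_on {x \<in> L. \<bar>form_prod Q x\<bar> < t}) \<and>
     ((\<lambda>t. infsum F {x \<in> L. \<bar>form_prod Q x\<bar> < t}) \<longlongrightarrow> s) at_top"

lemma Q_sums_zero: "Q_sums L Q (\<lambda>x. 0) 0"
  unfolding Q_sums_def by auto

lemma Q_sums_add: "Q_sums L Q F s \<Longrightarrow> Q_sums L Q G t \<Longrightarrow> Q_sums L Q (\<lambda>x. F x + G x) (s + t)"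
  unfolding Q_sums_def by (auto simp: infsum_add intro!: summable_on_add tendsto_add)

lemma Q_sums_cmult: "Q_sums L Q F s \<Longrightarrow> Q_sums L Q (\<lambda>x. c * F x) (c * s)"
  unfolding Q_sums_def by (auto simp: infsum_cmult_right' intro!: summable_on_cmult_right tendsto_mult_left)

lemma Q_sums_diff:
  assumes "Q_sums L Q F s" "Q_sums L Q G t"
  shows "Q_sums L Q (\<lambda>x. F x - G x) (s - t)"
  using Q_sums_add[OF assms(1) Q_sums_cmult[OF assms(2), of "-1"]] by simp

lemma Q_sums_sum:
  assumes "finite I" "\<And>i. i \<in> I \<Longrightarrow> Q_sums L Q (F i) (s i)"
  shows "Q_sums L Q (\<lambda>x. \<Sum>i\<in>I. F i x) (\<Sum>i\<in>I. s i)"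
  using assms by (induction I rule: finite_induct) (auto intro: Q_sums_zero Q_sums_add)

lemma Q_sums_cong:
  assumes "\<And>x. x \<in> L \<Longrightarrow> F x = G x"
  shows "Q_sums L Q F s \<longleftrightarrow> Q_sums L Q G s"
proof -
  have "F summable_on {x \<in> L. \<bar>form_prod Q x\<bar> < t} \<longleftrightarrow> G summable_on {x \<in> L. \<bar>form_prod Q x\<bar> < t}"
    "infsum F {x \<in> L. \<bar>form_prod Q x\<bar> < t} = infsum G {x \<in> L. \<bar>form_prod Q x\<bar> < t}" for t
    using assms by (auto intro!: summable_on_cong infsum_cong)
  then show ?thesis unfolding Q_sums_def by simp
qed

lemma Q_sums_unique: "Q_sums L Q F s \<Longrightarrow> Q_sums L Q F t \<Longrightarrow> s = t"
  unfolding Q_sums_def using tendsto_unique[OF trivial_limit_at_top_linorder] by blast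

text \<open>Points with vanishing denominator contribute 0, since division by zero yields 0, and
  points outside \<open>L\<close> contribute 0 by the case distinction. Enlarging the domain
  therefore alters no truncated sum.\<close>

lemma Q_sums_dedekind_sum:
  assumes conv: "dedekind_sum_converges L \<rho> e v Q" and L: "L \<subseteq> M"
  shows "Q_sums M Q (\<lambda>x. if x \<in> L then dedekind_term \<rho> e v x else 0) (dedekind_sum L \<rho> e v Q)"
proof -
  let ?F = "\<lambda>x. if x \<in> L then dedekind_term \<rho> e v x else 0"
  have 1: "?F summable_on {x \<in> M. \<bar>form_prod Q x\<bar> < t} \<longleftrightarrow>
      dedekind_term \<rho> e v summable_on truncated_support L \<rho> e Q t" for t
    using L by (intro summable_on_cong_neutral) (auto simp: truncated_support_def dedekind_term_def)
  have 2: "infsum ?F {x \<in> M. \<bar>form_prod Q x\<bar> < t} = truncated_dedekind_sum L \<rho> e v Q t" for t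
    unfolding truncated_dedekind_sum_def
    using L by (intro infsum_cong_neutral) (auto simp: truncated_support_def dedekind_term_def)
  obtain s where s: "(truncated_dedekind_sum L \<rho> e v Q \<longlongrightarrow> s) at_top"
    using conv unfolding dedekind_sum_converges_def by auto
  then have "dedekind_sum L \<rho> e v Q = s"
    unfolding dedekind_sum_def by (intro tendsto_Lim) auto
  with s conv show ?thesis
    unfolding Q_sums_def 1 2 dedekind_sum_converges_def by auto
qed

lemma transpose_mult_vec_scalar_prod:
  fixes A :: "real mat"
  assumes "A \<in> carrier_mat n n" "x \<in> carrier_vec n" "y \<in> carrier_vec n"
  shows "y \<bullet> (transpose_mat A *\<^sub>v x) = (A *\<^sub>v y) \<bullet> x"
proof -
  have "(transpose_mat A *\<^sub>v x) \<bullet> y = x \<bullet> (A *\<^sub>v y)"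
    using assms by (intro transpose_vec_mult_scalar)
  then show ?thesis
    using assms by (metis comm_scalar_prod mult_mat_vec_carrier transpose_carrier_mat)
qed

text \<open>\<open>Q_limits_exist\<close> is assumed for \<open>Q\<close> only, not for the forms
  pulled back along \<open>\<gamma>\<close>. The limit in the new coordinates is therefore
  transported: the bijection matches the truncation regions, so the truncated sums on both sides
  agree for every \<open>t\<close>.\<close>

lemma dedekind_sum_in_eqI:
  assumes F: "Q_sums L Q (\<lambda>x. if x \<in> H then F x else 0) s" and H: "H \<subseteq> L"
    and \<gamma>: "\<gamma> \<in> carrier_mat n n" and bij: "bij_betw (\<lambda>y. \<gamma> *\<^sub>v y) K H" and K: "K \<subseteq> carrier_vec n"
    and Q: "set Q \<subseteq> carrier_vec n"
    and pullback: "\<And>y. y \<in> K \<Longrightarrow> dedekind_term \<tau> e (transpose_mat \<gamma> *\<^sub>v v) y = F (\<gamma> *\<^sub>v y)"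
  shows "dedekind_sum_in \<gamma> K \<tau> e v Q = s"
proof -
  let ?v = "transpose_mat \<gamma> *\<^sub>v v" and ?Q = "map (\<lambda>q. transpose_mat \<gamma> *\<^sub>v q) Q"
  have Qy: "form_prod ?Q y = form_prod Q (\<gamma> *\<^sub>v y)" if "y \<in> K" for y
  proof -
    have "y \<bullet> (transpose_mat \<gamma> *\<^sub>v q) = (\<gamma> *\<^sub>v y) \<bullet> q" if "q \<in> set Q" for q
      using transpose_mult_vec_scalar_prod[OF \<gamma>] that \<open>y \<in> K\<close> K Q by blast
    then have "map (\<lambda>q. y \<bullet> (transpose_mat \<gamma> *\<^sub>v q)) Q = map (\<lambda>q. (\<gamma> *\<^sub>v y) \<bullet> q) Q" by simp
    then show ?thesis by (simp only: form_prod_def map_map comp_def)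
  qed
  have "truncated_dedekind_sum K \<tau> e ?v ?Q t =
      infsum (\<lambda>x. if x \<in> H then F x else 0) {x \<in> L. \<bar>form_prod Q x\<bar> < t}" for t
  proof -
    have "truncated_dedekind_sum K \<tau> e ?v ?Q t =
        infsum (dedekind_term \<tau> e ?v) {y \<in> K. \<bar>form_prod Q (\<gamma> *\<^sub>v y)\<bar> < t}"
      unfolding truncated_dedekind_sum_def
      by (intro infsum_cong_neutral) (auto simp: truncated_support_def dedekind_term_def Qy)
    also have "\<dots> = infsum (\<lambda>y. F (\<gamma> *\<^sub>v y)) {y \<in> K. \<bar>form_prod Q (\<gamma> *\<^sub>v y)\<bar> < t}"
      using pullback by (intro infsum_cong) auto
    also have "\<dots> = infsum F {x \<in> H. \<bar>form_prod Q x\<bar> < t}"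
    proof (rule infsum_reindex_bij_betw)
      show "bij_betw (\<lambda>y. \<gamma> *\<^sub>v y) {y \<in> K. \<bar>form_prod Q (\<gamma> *\<^sub>v y)\<bar> < t} {x \<in> H. \<bar>form_prod Q x\<bar> < t}"
        using bij by (auto simp: bij_betw_def inj_on_def)
    qed
    also have "\<dots> = infsum (\<lambda>x. if x \<in> H then F x else 0) {x \<in> L. \<bar>form_prod Q x\<bar> < t}"
      using H by (intro infsum_cong_neutral) auto
    finally show ?thesis .
  qed
  then have "truncated_dedekind_sum K \<tau> e ?v ?Q =
      (\<lambda>t. infsum (\<lambda>x. if x \<in> H then F x else 0) {x \<in> L. \<bar>form_prod Q x\<bar> < t})"
    by (rule ext)
  then have "(truncated_dedekind_sum K \<tau> e ?v ?Q \<longlongrightarrow> s) at_top"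
    using F unfolding Q_sums_def by simp
  then show ?thesis unfolding dedekind_sum_in_def dedekind_sum_def by (intro tendsto_Lim) auto
qed

text \<open>Where \<open>y \<bullet> p0\<close> is nonzero, this is multiplication by the relation
  divided by \<open>y \<bullet> p0\<close>; where it is zero, both sides vanish because
  \<open>p0\<close> occurs in every product. The case distinction keeps the zeros of
  \<open>i\<close> out of the sum even if the last copy of \<open>i\<close> has been removed, and it
  is the source of the sums of lower rank.\<close>

lemma partial_fraction_step:
  fixes y :: "real vec"
  assumes p0: "p0 \<in># U" and I: "I \<subseteq> set_mset U"
    and rel: "y \<bullet> p0 = (\<Sum>p\<in>I. a p * (y \<bullet> p))"
  shows "(\<Prod>p\<in>#U. inverse (y \<bullet> p)) = (\<Sum>i\<in>I. a i *
    (if y \<bullet> i = 0 then 0 else (\<Prod>p\<in>#add_mset p0 (U - {#i#}). inverse (y \<bullet> p))))"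
proof -
  let ?M = "\<lambda>U. \<Prod>p\<in>#U. inverse (y \<bullet> p)"
  have split: "?M U = inverse (y \<bullet> i) * ?M (U - {#i#})" if "i \<in># U" for i
    using that by (subst insert_DiffM[OF that, symmetric]) (simp del: insert_DiffM)
  have "(\<Sum>i\<in>I. a i * (if y \<bullet> i = 0 then 0 else ?M (add_mset p0 (U - {#i#})))) =
      (\<Sum>i\<in>I. a i * (y \<bullet> i) * (inverse (y \<bullet> p0) * ?M U))"
    using I split by (intro sum.cong) (auto simp: subset_iff)
  also have "\<dots> = (y \<bullet> p0) * (inverse (y \<bullet> p0) * ?M U)"
    unfolding rel sum_distrib_right ..
  also have "\<dots> = ?M U" using split[OF p0] by (cases "y \<bullet> p0 = 0") auto
  finally show ?thesis by simp
qed

section \<open>Finite rational combinations of a family of sums\<close>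

definition rat_span :: "('i \<Rightarrow> complex) \<Rightarrow> 'i set \<Rightarrow> complex set" where
  "rat_span f B = {s. \<exists>A q. finite A \<and> A \<subseteq> B \<and> s = (\<Sum>b\<in>A. of_rat (q b) * f b)}"

lemma rat_span_zero: "0 \<in> rat_span f B"
  unfolding rat_span_def by (intro CollectI exI[of _ "{}"]) auto

lemma rat_span_base: "b \<in> B \<Longrightarrow> f b \<in> rat_span f B"
  unfolding rat_span_def by (intro CollectI exI[of _ "{b}"] exI[of _ "\<lambda>_. 1"]) auto

lemma rat_span_scale: "s \<in> rat_span f B \<Longrightarrow> of_rat r * s \<in> rat_span f B"
proof -
  assume "s \<in> rat_span f B"
  then obtain A q where A: "finite A" "A \<subseteq> B" "s = (\<Sum>b\<in>A. of_rat (q b) * f b)"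
    unfolding rat_span_def by auto
  have "of_rat r * s = (\<Sum>b\<in>A. of_rat (r * q b) * f b)"
    unfolding A(3) sum_distrib_left by (simp add: of_rat_mult mult.assoc)
  with A show ?thesis unfolding rat_span_def
    by (intro CollectI exI[of _ A] exI[of _ "\<lambda>b. r * q b"]) auto
qed

lemma rat_span_add:
  assumes "s \<in> rat_span f B" "t \<in> rat_span f B"
  shows "s + t \<in> rat_span f B"
proof -
  obtain A q A' q' where A: "finite A" "A \<subseteq> B" "s = (\<Sum>b\<in>A. of_rat (q b) * f b)"
    and A': "finite A'" "A' \<subseteq> B" "t = (\<Sum>b\<in>A'. of_rat (q' b) * f b)"
    using assms unfolding rat_span_def by auto
  have "s = (\<Sum>b\<in>A \<union> A'. of_rat (if b \<in> A then q b else 0) * f b)"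
    unfolding A(3) using A(1) A'(1) by (intro sum.mono_neutral_cong_left) auto
  moreover have "t = (\<Sum>b\<in>A \<union> A'. of_rat (if b \<in> A' then q' b else 0) * f b)"
    unfolding A'(3) using A(1) A'(1) by (intro sum.mono_neutral_cong_left) auto
  ultimately have "s + t =
      (\<Sum>b\<in>A \<union> A'. of_rat ((if b \<in> A then q b else 0) + (if b \<in> A' then q' b else 0)) * f b)"
    by (simp only: of_rat_add distrib_right sum.distrib)
  with A A' show ?thesis unfolding rat_span_def
    by (intro CollectI exI[of _ "A \<union> A'"]
        exI[of _ "\<lambda>b. (if b \<in> A then q b else 0) + (if b \<in> A' then q' b else 0)"]) auto
qed

subsection \<open>Coordinate changes\<close>

definition block_extend :: "nat \<Rightarrow> nat \<Rightarrow> real mat \<Rightarrow> real mat" where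
  "block_extend n l \<gamma> = four_block_mat \<gamma> (0\<^sub>m l (n - l)) (0\<^sub>m (n - l) l) (1\<^sub>m (n - l))"

lemma block_extend_carrier:
  assumes "\<gamma> \<in> carrier_mat l l" "l \<le> n"
  shows "block_extend n l \<gamma> \<in> carrier_mat n n"
  using four_block_carrier_mat[OF assms(1) one_carrier_mat[of "n - l"]] assms(2)
  unfolding block_extend_def by simp

lemma block_extend_mult_vec:
  assumes "\<gamma> \<in> carrier_mat l l" "a \<in> carrier_vec l"
  shows "block_extend n l \<gamma> *\<^sub>v (a @\<^sub>v 0\<^sub>v (n - l)) = (\<gamma> *\<^sub>v a) @\<^sub>v 0\<^sub>v (n - l)"
  unfolding block_extend_def
  using mult_mat_vec_split[OF assms(1) one_carrier_mat[of "n - l"] assms(2) zero_carrier_vec[of "n - l"]]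
  by simp

lemma vec_first_block_extend_mult_vec:
  assumes "\<gamma> \<in> carrier_mat l l" "l \<le> n" "x \<in> Z_span n l"
  shows "vec_first (block_extend n l \<gamma> *\<^sub>v x) l = \<gamma> *\<^sub>v vec_first x l"
proof -
  obtain a where a: "x = a @\<^sub>v 0\<^sub>v (n - l)" "a \<in> carrier_vec l"
    using assms(3) unfolding Z_span_as_image[OF assms(2)] by auto
  then show ?thesis using block_extend_mult_vec[OF assms(1) a(2)] assms(1)
    by (simp add: vec_first_append)
qed

lemma block_extend_image_Z_span:
  assumes \<gamma>: "unimodular l \<gamma>" and l: "l \<le> n"
  shows "bij_betw (\<lambda>x. block_extend n l \<gamma> *\<^sub>v x) (Z_span n l) (Z_span n l)"
proof -
  obtain \<delta> where \<delta>: "\<gamma> \<in> carrier_mat l l" "integral_mat \<gamma>" "\<delta> \<in> carrier_mat l l" "integral_mat \<delta>"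
    "\<gamma> * \<delta> = 1\<^sub>m l" "\<delta> * \<gamma> = 1\<^sub>m l" using \<gamma> unfolding unimodular_def by auto
  have maps: "block_extend n l \<alpha> *\<^sub>v x \<in> Z_span n l"
    if \<alpha>: "\<alpha> \<in> carrier_mat l l" "integral_mat \<alpha>" and x: "x \<in> Z_span n l" for \<alpha> x
  proof -
    obtain a where a: "x = a @\<^sub>v 0\<^sub>v (n - l)" "a \<in> carrier_vec l" "integral_vec a"
      using x unfolding Z_span_as_image[OF l] by auto
    then show ?thesis unfolding a(1) block_extend_mult_vec[OF \<alpha>(1) a(2)] Z_span_as_image[OF l]
      using \<alpha> a by (intro imageI) (auto intro!: integral_mult_mat_vec)
  qed
  have inv: "block_extend n l \<alpha> *\<^sub>v (block_extend n l \<beta> *\<^sub>v x) = x"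
    if \<alpha>\<beta>: "\<alpha> \<in> carrier_mat l l" "\<beta> \<in> carrier_mat l l" "\<alpha> * \<beta> = 1\<^sub>m l" and x: "x \<in> Z_span n l" for \<alpha> \<beta> x
  proof -
    obtain a where a: "x = a @\<^sub>v 0\<^sub>v (n - l)" "a \<in> carrier_vec l"
      using x unfolding Z_span_as_image[OF l] by auto
    have "\<alpha> *\<^sub>v (\<beta> *\<^sub>v a) = a"
      using assoc_mult_mat_vec[OF \<alpha>\<beta>(1,2) a(2)] \<alpha>\<beta>(3) a(2) by simp
    then show ?thesis unfolding a(1)
      using \<alpha>\<beta> a(2) by (simp add: block_extend_mult_vec[of _ l])
  qed
  show ?thesis
    by (rule bij_betw_byWitness[where f' = "\<lambda>x. block_extend n l \<delta> *\<^sub>v x"])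
      (use \<delta> maps inv in auto)
qed

lemma coord_change_block_extend:
  assumes \<gamma>: "unimodular l \<gamma>" and l: "l \<le> n"
  shows "coord_change n l (block_extend n l \<gamma>)"
  unfolding coord_change_def
proof (intro conjI allI impI)
  have \<gamma>c: "\<gamma> \<in> carrier_mat l l" "integral_mat \<gamma>" "\<bar>det \<gamma>\<bar> = 1"
    using \<gamma> by (auto simp: unimodular_def)
  show "block_extend n l \<gamma> \<in> carrier_mat n n" by (rule block_extend_carrier[OF \<gamma>c(1) l])
  fix i j assume "i < n" "j < n"
  then show "block_extend n l \<gamma> $$ (i, j) \<in> \<int>"
    using \<gamma>c l by (auto simp: block_extend_def integral_mat_def)
next
  have \<gamma>c: "\<gamma> \<in> carrier_mat l l" "\<bar>det \<gamma>\<bar> = 1"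
    using \<gamma> by (auto simp: unimodular_def)
  have "det (block_extend n l \<gamma>) = det \<gamma> * det (1\<^sub>m (n - l))"
    unfolding block_extend_def
    by (rule det_four_block_mat_lower_left_zero[OF \<gamma>c(1) _ refl]) auto
  then show "\<bar>det (block_extend n l \<gamma>)\<bar> = 1" using \<gamma>c(2) by simp
  show "(\<lambda>x. block_extend n l \<gamma> *\<^sub>v x) ` Z_span n l = Z_span n l"
    using block_extend_image_Z_span[OF assms] by (simp add: bij_betw_def)
qed

lemma of_real_of_rat: "(of_real (of_rat q) :: complex) = of_rat q"
  by (cases q) (simp add: of_rat_rat)

subsection \<open>Reduction of a normalized Dedekind sum\<close>

text \<open>The determinant is taken to be nonzero, as this makes the forms induced by the columns
  span. If it is zero, every term vanishes and so does the sum.\<close>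

locale dedekind_data =
  fixes n l :: nat and \<sigma> :: "real mat" and e :: "nat \<Rightarrow> nat" and v :: "real vec" and Q :: "real vec list"
  assumes l_pos: "1 \<le> l" and l_le_n: "l \<le> n"
    and \<sigma>: "\<sigma> \<in> carrier_mat n n" and v: "v \<in> carrier_vec n"
    and Q: "Q_forms n Q" and Q_limits: "Q_limits_exist n Q"
    and norm: "normalized n l (Z_span n l) \<sigma>"
    and e: "properly_embedded n e"
    and det_nonzero: "det \<sigma> \<noteq> 0"
begin

abbreviation forms :: "real vec set" where
  "forms \<equiv> proj_col l \<sigma> ` {..<n}"

abbreviation term_of :: "real vec multiset \<Rightarrow> real vec \<Rightarrow> complex" where
  "term_of \<equiv> form_term l (det \<sigma>) v"

abbreviation sums_to :: "(real vec \<Rightarrow> complex) \<Rightarrow> complex \<Rightarrow> bool" where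
  "sums_to \<equiv> Q_sums (Z_span n l) Q"

text \<open>The invariant of the reduction: \<open>n\<close> forms fill the columns of an
  \<open>n\<close> by \<open>n\<close> matrix, membership in \<open>forms\<close> bounds the index,
  and spanning permits a nonzero determinant.\<close>

definition admissible :: "real vec multiset \<Rightarrow> bool" where
  "admissible U \<longleftrightarrow> size U = n \<and> set_mset U \<subseteq> forms \<and> nondegenerate l (set_mset U)"

definition diagonals :: "real mat set" where
  "diagonals = {\<rho> \<in> carrier_mat n n. normalized n l (Z_span n l) \<rho> \<and> diagonal n l \<rho> \<and>
     dedekind_index n l \<rho> \<le> dedekind_index n l \<sigma>}"

definition lower_sums :: "(real mat \<times> real mat) set" where
  "lower_sums = {(\<tau>, \<gamma>). \<tau> \<in> carrier_mat n n \<and> coord_change n l \<gamma> \<and>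
     normalized n (l - 1) (Z_span n (l - 1)) \<tau> \<and>
     dedekind_index n (l - 1) \<tau> \<le> dedekind_index n l \<sigma>}"

definition reducible :: "complex set" where
  "reducible = {a + b | a b.
     a \<in> rat_span (\<lambda>\<rho>. dedekind_sum (Z_span n l) \<rho> e v Q) diagonals \<and>
     b \<in> rat_span (\<lambda>(\<tau>, \<gamma>). dedekind_sum_in \<gamma> (Z_span n (l - 1)) \<tau> e v Q) lower_sums}"

lemma reducible_add: "s \<in> reducible \<Longrightarrow> t \<in> reducible \<Longrightarrow> s + t \<in> reducible"
proof -
  assume "s \<in> reducible" "t \<in> reducible"
  then obtain a b a' b' where
    "a \<in> rat_span (\<lambda>\<rho>. dedekind_sum (Z_span n l) \<rho> e v Q) diagonals"
    "a' \<in> rat_span (\<lambda>\<rho>. dedekind_sum (Z_span n l) \<rho> e v Q) diagonals"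
    "b \<in> rat_span (\<lambda>(\<tau>, \<gamma>). dedekind_sum_in \<gamma> (Z_span n (l - 1)) \<tau> e v Q) lower_sums"
    "b' \<in> rat_span (\<lambda>(\<tau>, \<gamma>). dedekind_sum_in \<gamma> (Z_span n (l - 1)) \<tau> e v Q) lower_sums"
    "s = a + b" "t = a' + b'" unfolding reducible_def by auto
  then show ?thesis unfolding reducible_def
    by (intro CollectI exI[of _ "a + a'"] exI[of _ "b + b'"]) (auto intro: rat_span_add)
qed

lemma reducible_scale: "s \<in> reducible \<Longrightarrow> of_rat r * s \<in> reducible"
proof -
  assume "s \<in> reducible"
  then obtain a b where
    "a \<in> rat_span (\<lambda>\<rho>. dedekind_sum (Z_span n l) \<rho> e v Q) diagonals"
    "b \<in> rat_span (\<lambda>(\<tau>, \<gamma>). dedekind_sum_in \<gamma> (Z_span n (l - 1)) \<tau> e v Q) lower_sums"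
    "s = a + b" unfolding reducible_def by auto
  then show ?thesis unfolding reducible_def
    by (intro CollectI exI[of _ "of_rat r * a"] exI[of _ "of_rat r * b"])
      (auto intro: rat_span_scale simp: distrib_left)
qed

lemma reducible_zero: "0 \<in> reducible"
  unfolding reducible_def by (intro CollectI exI[of _ 0]) (auto intro: rat_span_zero)

lemma reducible_diff: "s \<in> reducible \<Longrightarrow> t \<in> reducible \<Longrightarrow> s - t \<in> reducible"
  using reducible_add[of s "of_rat (-1) * t"] reducible_scale[of t "-1"] by (simp add: of_rat_minus)

lemma reducible_sum: "finite I \<Longrightarrow> (\<And>i. i \<in> I \<Longrightarrow> f i \<in> reducible) \<Longrightarrow> (\<Sum>i\<in>I. f i) \<in> reducible"
  by (induction I rule: finite_induct) (auto intro: reducible_zero reducible_add)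

lemma reducible_diagonal: "\<rho> \<in> diagonals \<Longrightarrow> dedekind_sum (Z_span n l) \<rho> e v Q \<in> reducible"
  unfolding reducible_def
  by (intro CollectI exI[of _ "dedekind_sum (Z_span n l) \<rho> e v Q"] exI[of _ 0])
    (auto intro: rat_span_zero rat_span_base)

lemma reducible_lower:
  assumes "(\<tau>, \<gamma>) \<in> lower_sums"
  shows "dedekind_sum_in \<gamma> (Z_span n (l - 1)) \<tau> e v Q \<in> reducible"
  using rat_span_base[OF assms, of "\<lambda>(\<tau>, \<gamma>). dedekind_sum_in \<gamma> (Z_span n (l - 1)) \<tau> e v Q"]
  unfolding reducible_def
  by (intro CollectI exI[of _ 0] exI[of _ "dedekind_sum_in \<gamma> (Z_span n (l - 1)) \<tau> e v Q"])
    (auto intro: rat_span_zero)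

lemma forms_props:
  assumes "p \<in> forms"
  shows "p \<in> carrier_vec l" "primitive_integral p" "integral_vec p" "p \<noteq> 0\<^sub>v l"
proof -
  show "p \<in> carrier_vec l" using assms by (auto simp: proj_col_def)
  have "\<forall>j<n. primitive_integral (proj_col l \<sigma> j)"
    using norm unfolding normalized_def by (elim conjE)
  then show "primitive_integral p" using assms by auto
  then show "integral_vec p" "p \<noteq> 0\<^sub>v l"
    using primitive_integral_imp_integral primitive_integral_nonzero by auto
qed

lemma forms_not_proportional:
  assumes "p \<in> forms" "r \<in> forms" "p = c \<cdot>\<^sub>v r"
  shows "p = r"
proof -
  obtain i j where "i < n" "j < n" "p = proj_col l \<sigma> i" "r = proj_col l \<sigma> j" using assms by auto
  moreover have "\<forall>i<n. \<forall>j<n. (\<exists>c. proj_col l \<sigma> i = c \<cdot>\<^sub>v proj_col l \<sigma> j) \<longrightarrow>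
      proj_col l \<sigma> i = proj_col l \<sigma> j"
    using norm unfolding normalized_def by (elim conjE)
  ultimately show ?thesis using assms(3) by blast
qed

text \<open>For \<open>l = n\<close> the induced forms are the whole columns, hence integral. This
  is the rationality that \<open>realize_columns_by_matrix\<close> requires when no rows are
  free.\<close>

lemma det_rational: "l = n \<Longrightarrow> det \<sigma> \<in> \<rat>"
proof -
  assume ln: "l = n"
  have "\<sigma> $$ (i, j) \<in> \<int>" if "i < n" "j < n" for i j
  proof -
    have "integral_vec (proj_col l \<sigma> j)" using forms_props(3) that by blast
    then have "proj_col l \<sigma> j $ i \<in> \<int>" using that ln by (simp add: integral_vec_def proj_col_def)
    moreover have "proj_col l \<sigma> j $ i = \<sigma> $$ (i, j)"
      using that ln \<sigma> by (simp add: proj_col_def vec_first_def)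
    ultimately show ?thesis by simp
  qed
  then have "det \<sigma> \<in> \<int>" using det_in_Ints[OF \<sigma>] by blast
  then show ?thesis using Ints_subset_Rats by blast
qed

section \<open>From multisets of forms back to Dedekind sums\<close>

lemma realize_admissible:
  assumes "admissible U"
  obtains \<rho> us q where "\<rho> \<in> carrier_mat n n" "length us = n" "mset us = U" "adjacent_classes us"
    "\<And>j. j < n \<Longrightarrow> proj_col l \<rho> j = us ! j" "det \<sigma> = of_rat q * det \<rho>"
proof -
  have U: "size U = n" "set_mset U \<subseteq> forms" "nondegenerate l (set_mset U)"
    using assms by (auto simp: admissible_def)
  obtain us where us: "mset us = U" "adjacent_classes us" using ex_adjacent_arrangement by blast
  have len: "length us = n" using us U by (metis size_mset)
  have set_us: "set us = set_mset U" using us by (metis set_mset_mset)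
  have "set us \<subseteq> carrier_vec l" "\<And>u. u \<in> set us \<Longrightarrow> integral_vec u"
    using forms_props U(2) set_us by auto
  then obtain \<rho> q where "\<rho> \<in> carrier_mat n n" "\<And>j. j < n \<Longrightarrow> proj_col l \<rho> j = us ! j"
      "det \<sigma> = of_rat q * det \<rho>"
    using realize_columns_by_matrix[OF len _ l_le_n, of "det \<sigma>"] U(3) set_us det_nonzero det_rational
    by metis
  with us len that show ?thesis by blast
qed

text \<open>The integrality demanded by \<open>Q_limits_exist\<close> holds because a point of
  \<open>Z_span n l\<close> meets only the first \<open>l\<close> entries of a column, and these
  form an integral vector. A general subgroup \<open>L\<close> is allowed so that the same matrix
  evaluates the full sum as well as its part on a hyperplane. The factor \<open>q\<close> converts
  \<open>det \<rho>\<close> into \<open>det \<sigma>\<close>.\<close>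

lemma sums_to_realized:
  assumes U: "set_mset U \<subseteq> forms"
    and \<rho>: "\<rho> \<in> carrier_mat n n" "length us = n" "mset us = U"
      "\<And>j. j < n \<Longrightarrow> proj_col l \<rho> j = us ! j" "det \<sigma> = of_rat q * det \<rho>"
    and L: "L \<subseteq> Z_span n l" "0\<^sub>v n \<in> L" "\<And>x y. x \<in> L \<Longrightarrow> y \<in> L \<Longrightarrow> x - y \<in> L"
  shows "sums_to (\<lambda>x. if x \<in> L then term_of U x else 0) (of_rat q * dedekind_sum L \<rho> e v Q)"
proof -
  have us: "us ! j \<in> forms" if "j < n" for j
    using U \<rho>(2,3) that by (metis nth_mem set_mset_mset subsetD)
  have integral: "x \<bullet> col \<rho> j \<in> \<int>" if "x \<in> L" "j < n" for x j
  proof -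
    have x: "x \<in> Z_span n l" using that L by auto
    have "col \<rho> j \<in> carrier_vec n" using \<rho>(1) by (metis col_dim carrier_matD(1))
    then have "x \<bullet> col \<rho> j = vec_first x l \<bullet> us ! j"
      using scalar_prod_vec_first[of x n "col \<rho> j" l] Z_spanD[OF x] l_le_n \<rho>(4)[OF that(2)]
      by (simp add: proj_col_def)
    moreover have "integral_vec (vec_first x l)"
      using Z_spanD[OF x] l_le_n by (auto simp: integral_vec_def vec_first_def)
    ultimately show ?thesis
      using integral_scalar_prod[of "vec_first x l" "us ! j"] forms_props[OF us[OF that(2)]] by simp
  qed
  have "L \<subseteq> Z_span n n" using L(1) l_le_n unfolding Z_span_def by auto
  then have "dedekind_sum_converges L \<rho> (\<lambda>_. 1) v Q"
    using L(2,3) integral v \<rho>(1) by (intro Q_limits[unfolded Q_limits_exist_def, rule_format]) auto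
  from Q_sums_cmult[OF Q_sums_dedekind_sum[OF this L(1)], of "of_rat q"]
  have sums: "sums_to (\<lambda>x. of_rat q * (if x \<in> L then dedekind_term \<rho> (\<lambda>_. 1) v x else 0))
      (of_rat q * dedekind_sum L \<rho> e v Q)"
    unfolding dedekind_sum_unit_exponents[OF \<rho>(1) e] .
  have eq: "of_rat q * (if x \<in> L then dedekind_term \<rho> (\<lambda>_. 1) v x else 0) =
      (if x \<in> L then term_of U x else 0)" if "x \<in> Z_span n l" for x
  proof -
    have "dedekind_term \<rho> (\<lambda>_. 1) v x = form_term l (det \<rho>) v U x"
      using dedekind_term_conv_form_term[OF \<rho>(1) l_le_n that \<rho>(2,4)] \<rho>(3)
      by (simp add: properly_embedded_def)
    then show ?thesis by (simp add: form_term_def \<rho>(5) of_real_of_rat mult_ac)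
  qed
  show ?thesis by (rule iffD1[OF Q_sums_cong sums]) (rule eq)
qed

text \<open>An adjacent arrangement of the multiset is realized by a matrix that is already
  normalized and diagonal. Its forms are among those of \<open>\<sigma>\<close>, hence so are its
  minors up to sign.\<close>

lemma diagonal_case:
  assumes U: "admissible U" and card: "card (set_mset U) = l"
  shows "\<exists>s\<in>reducible. sums_to (term_of U) s"
proof -
  obtain \<rho> us q where \<rho>: "\<rho> \<in> carrier_mat n n" "length us = n" "mset us = U" "adjacent_classes us"
    "\<And>j. j < n \<Longrightarrow> proj_col l \<rho> j = us ! j" "det \<sigma> = of_rat q * det \<rho>"
    using realize_admissible[OF U] by metis
  have U': "set us \<subseteq> forms" using U \<rho>(3) unfolding admissible_def by auto
  have img: "proj_col l \<rho> ` {..<n} = set us"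
    using \<rho>(2,5) by (auto simp: set_conv_nth)
  have "normalized n l (Z_span n l) \<rho>"
  proof (rule normalizedI[OF \<rho>(2,5,4)])
    show "primitive_integral u" if "u \<in> set us" for u using forms_props(2) U' that by blast
    show "u = w" if "u \<in> set us" "w \<in> set us" "u = c \<cdot>\<^sub>v w" for u w c
      using forms_not_proportional[of u w c] U' that by blast
  qed
  moreover have "diagonal n l \<rho>"
    using card \<rho>(3) unfolding diagonal_def img by auto
  moreover have "dedekind_index n l \<rho> \<le> dedekind_index n l \<sigma>"
    using U' unfolding img[symmetric]
    by (intro dedekind_index_le[OF l_le_n] dedekind_index_ge[OF l_le_n]) auto
  ultimately have "\<rho> \<in> diagonals" unfolding diagonals_def using \<rho>(1) by auto
  then have red: "of_rat q * dedekind_sum (Z_span n l) \<rho> e v Q \<in> reducible"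
    by (intro reducible_scale reducible_diagonal)
  have "0\<^sub>v n \<in> Z_span n l" by (simp add: Z_span_def)
  then have "sums_to (\<lambda>x. if x \<in> Z_span n l then term_of U x else 0)
      (of_rat q * dedekind_sum (Z_span n l) \<rho> e v Q)"
    using U \<rho> Z_span_subgroup by (intro sums_to_realized[of U \<rho> us q]) (auto simp: admissible_def)
  then have "sums_to (term_of U) (of_rat q * dedekind_sum (Z_span n l) \<rho> e v Q)"
    by (subst Q_sums_cong[of _ _ "\<lambda>x. if x \<in> Z_span n l then term_of U x else 0"]) auto
  with red show ?thesis by blast
qed

text \<open>Coordinates adapted to \<open>p\<close> identify the hyperplane with the standard
  lattice of rank \<open>l - 1\<close>. Since \<open>p\<close> does not occur in \<open>U\<close>,
  no form of \<open>U\<close> vanishes identically there. For \<open>l = 1\<close> the hypotheses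
  contradict each other: all forms are proportional, hence equal, and \<open>U\<close> is not
  empty.\<close>

lemma hyperplane_case:
  assumes U: "admissible U" and p: "p \<in> forms" "p \<notin># U"
  shows "\<exists>s\<in>reducible. sums_to (\<lambda>x. if vec_first x l \<bullet> p = 0 then term_of U x else 0) s"
proof -
  let ?k = "l - 1"
  define H where "H = {x \<in> Z_span n l. vec_first x l \<bullet> p = 0}"
  have pc: "p \<in> carrier_vec l" "integral_vec p" "p \<noteq> 0\<^sub>v l" using forms_props[OF p(1)] by auto
  have U': "size U = n" "set_mset U \<subseteq> forms" "nondegenerate l (set_mset U)"
    using U by (auto simp: admissible_def)
  have Uc: "r \<in> carrier_vec l" "integral_vec r" "r \<in> forms" if "r \<in># U" for r
    using forms_props U'(2) that by auto
  have H0: "0\<^sub>v n \<in> H"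
  proof -
    have "vec_first (0\<^sub>v n) l = (0\<^sub>v l :: real vec)" using l_le_n by (auto simp: vec_first_def)
    then show ?thesis using pc(1) by (simp add: H_def Z_span_def)
  qed
  have Hdiff: "x - y \<in> H" if "x \<in> H" "y \<in> H" for x y
  proof -
    have xy: "x \<in> Z_span n l" "y \<in> Z_span n l" using that by (auto simp: H_def)
    have "vec_first (x - y) l = vec_first x l - vec_first y l"
      using Z_spanD(1)[OF xy(1)] Z_spanD(1)[OF xy(2)] l_le_n
      by (intro eq_vecI) (auto simp: vec_first_def)
    then have "vec_first (x - y) l \<bullet> p = 0"
      using that pc(1) by (simp add: H_def minus_scalar_prod_distrib[of _ l])
    then show ?thesis using Z_span_subgroup[OF xy] by (simp add: H_def)
  qed
  obtain \<rho> us q where \<rho>: "\<rho> \<in> carrier_mat n n" "length us = n" "mset us = U"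
    "\<And>j. j < n \<Longrightarrow> proj_col l \<rho> j = us ! j" "det \<sigma> = of_rat q * det \<rho>"
    using realize_admissible[OF U] by metis
  \<comment> \<open>The limit over \<open>H\<close> exists because a matrix for \<open>U\<close>
    itself, still with forms of rank \<open>l\<close>, can be summed over the subgroup
    \<open>H\<close>. Only its value remains to be identified with a sum of lower rank.\<close>
  define h where "h = of_rat q * dedekind_sum H \<rho> e v Q"
  have h: "sums_to (\<lambda>x. if x \<in> H then term_of U x else 0) h"
    unfolding h_def using H0 Hdiff
    by (intro sums_to_realized[OF U'(2) \<rho>]) (auto simp: H_def)

  \<comment> \<open>In the new coordinates \<open>p\<close> is \<open>g\<close> times the last
    coordinate, so that \<open>H\<close> becomes the lattice on which the last coordinate is
    0.\<close>
  obtain \<gamma>0 g where \<gamma>0: "unimodular l \<gamma>0" and g: "transpose_mat \<gamma>0 *\<^sub>v p = g \<cdot>\<^sub>v unit_vec l ?k"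
    using unimodular_straighten_form[OF l_pos pc(1,2)] by blast
  have \<gamma>0c: "\<gamma>0 \<in> carrier_mat l l" "integral_mat \<gamma>0" using \<gamma>0 by (auto simp: unimodular_def)
  have trc: "transpose_mat \<gamma>0 *\<^sub>v r \<in> carrier_vec l" if "r \<in> carrier_vec l" for r
    using \<gamma>0c(1) that by (intro mult_mat_vec_carrier[of _ l l]) auto
  have g_int: "g \<in> \<int>"
  proof -
    have "integral_vec (g \<cdot>\<^sub>v unit_vec l ?k)"
      unfolding g[symmetric] using \<gamma>0c pc
      by (intro integral_mult_mat_vec integral_mat_transpose) auto
    then show ?thesis using l_pos by (auto simp: integral_vec_def dest!: spec[of _ ?k])
  qed
  have "g \<noteq> 0"
  proof
    assume "g = 0"
    then have "transpose_mat \<gamma>0 *\<^sub>v p = transpose_mat \<gamma>0 *\<^sub>v 0\<^sub>v l"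
      unfolding g using \<gamma>0c(1) by (intro eq_vecI) auto
    then show False using unimodular_transpose_cancel[OF \<gamma>0 pc(1) zero_carrier_vec] pc(3) by blast
  qed
  then have g1: "\<bar>g\<bar> \<ge> 1" using g_int by (auto elim!: Ints_cases)

  define \<gamma> where "\<gamma> = block_extend n l \<gamma>0"
  have \<gamma>c: "\<gamma> \<in> carrier_mat n n" unfolding \<gamma>_def by (rule block_extend_carrier[OF \<gamma>0c(1) l_le_n])
  have cc: "coord_change n l \<gamma>" unfolding \<gamma>_def by (rule coord_change_block_extend[OF \<gamma>0 l_le_n])
  have pairing: "vec_first (\<gamma> *\<^sub>v y) l \<bullet> r = vec_first y l \<bullet> (transpose_mat \<gamma>0 *\<^sub>v r)"
    if "y \<in> Z_span n l" "r \<in> carrier_vec l" for y r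
    unfolding \<gamma>_def vec_first_block_extend_mult_vec[OF \<gamma>0c(1) l_le_n that(1)]
    using transpose_mult_vec_scalar_prod[OF \<gamma>0c(1) that(2), of "vec_first y l"] by simp
  have pairing_p: "vec_first (\<gamma> *\<^sub>v y) l \<bullet> p = g * y $ ?k" if "y \<in> Z_span n l" for y
    using pairing[OF that pc(1)] l_pos unfolding g by (simp add: vec_first_def)
  have K: "Z_span n ?k = {y \<in> Z_span n l. y $ ?k = 0}"
  proof -
    have "(\<forall>i<n. ?k \<le> i \<longrightarrow> y $ i = 0) \<longleftrightarrow> (\<forall>i<n. l \<le> i \<longrightarrow> y $ i = 0) \<and> y $ ?k = 0"
      for y :: "real vec"
    proof -
      have "?k < n" "\<And>i. ?k \<le> i \<longleftrightarrow> i = ?k \<or> l \<le> i" using l_pos l_le_n by auto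
      then show ?thesis by metis
    qed
    then show ?thesis unfolding Z_span_def by blast
  qed
  have "(\<lambda>y. \<gamma> *\<^sub>v y) ` Z_span n ?k = H"
  proof -
    have img: "(\<lambda>y. \<gamma> *\<^sub>v y) ` Z_span n l = Z_span n l" using cc by (simp add: coord_change_def)
    have "\<gamma> *\<^sub>v y \<in> H \<longleftrightarrow> y $ ?k = 0" if "y \<in> Z_span n l" for y
      using pairing_p[OF that] \<open>g \<noteq> 0\<close> img that by (auto simp: H_def)
    then have "(\<lambda>y. \<gamma> *\<^sub>v y) ` {y \<in> Z_span n l. y $ ?k = 0} = {x \<in> (\<lambda>y. \<gamma> *\<^sub>v y) ` Z_span n l. x \<in> H}"
      by blast
    then show ?thesis unfolding img K by (auto simp: H_def)
  qed
  then have bij: "bij_betw (\<lambda>y. \<gamma> *\<^sub>v y) (Z_span n ?k) H"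
    using bij_betw_subset[OF block_extend_image_Z_span[OF \<gamma>0 l_le_n]] K unfolding \<gamma>_def by blast

  define restr where "restr r = vec_first (transpose_mat \<gamma>0 *\<^sub>v r) ?k" for r
  have pairing_K: "vec_first (\<gamma> *\<^sub>v y) l \<bullet> r = vec_first y ?k \<bullet> restr r"
    if "y \<in> Z_span n ?k" "r \<in> carrier_vec l" for y r
  proof -
    have y: "y \<in> Z_span n l" using that(1) K by auto
    have "vec_first y l \<bullet> (transpose_mat \<gamma>0 *\<^sub>v r) = vec_first (vec_first y l) ?k \<bullet> restr r"
      unfolding restr_def using trc[OF that(2)] Z_spanD(3)[OF that(1)] l_le_n
      by (intro scalar_prod_vec_first) (auto simp: vec_first_def)
    moreover have "vec_first (vec_first y l) ?k = vec_first y ?k"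
      by (intro eq_vecI) (auto simp: vec_first_def)
    ultimately show ?thesis using pairing[OF y that(2)] by simp
  qed
  have restr: "restr r \<in> carrier_vec ?k" "integral_vec (restr r)" "restr r \<noteq> 0\<^sub>v ?k" if "r \<in># U" for r
  proof -
    show "restr r \<in> carrier_vec ?k" by (simp add: restr_def)
    have "integral_vec (transpose_mat \<gamma>0 *\<^sub>v r)"
      using \<gamma>0c Uc[OF that] by (intro integral_mult_mat_vec integral_mat_transpose) auto
    then show "integral_vec (restr r)"
      using \<gamma>0c(1) unfolding integral_vec_def restr_def by (auto simp: vec_first_def)
    \<comment> \<open>A form that vanishes on the hyperplane is proportional to \<open>p\<close>,
      hence equal to \<open>p\<close> by normalization, which is excluded by
      \<open>p \<notin># U\<close>.\<close>
    show "restr r \<noteq> 0\<^sub>v ?k"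
    proof
      assume zero: "restr r = 0\<^sub>v ?k"
      define c where "c = (transpose_mat \<gamma>0 *\<^sub>v r) $ ?k / g"
      have "transpose_mat \<gamma>0 *\<^sub>v r = c \<cdot>\<^sub>v (transpose_mat \<gamma>0 *\<^sub>v p)"
      proof (intro eq_vecI)
        fix i assume "i < dim_vec (c \<cdot>\<^sub>v (transpose_mat \<gamma>0 *\<^sub>v p))"
        then have i: "i < l" using \<gamma>0c(1) by simp
        show "(transpose_mat \<gamma>0 *\<^sub>v r) $ i = (c \<cdot>\<^sub>v (transpose_mat \<gamma>0 *\<^sub>v p)) $ i"
        proof (cases "i = ?k")
          case True
          then show ?thesis using i \<open>g \<noteq> 0\<close> unfolding g c_def by simp
        next
          case False
          then have "i < ?k" using i by simp
          then have "(transpose_mat \<gamma>0 *\<^sub>v r) $ i = restr r $ i"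
            unfolding restr_def vec_first_def by (simp only: index_vec)
          then have "(transpose_mat \<gamma>0 *\<^sub>v r) $ i = 0" using zero \<open>i < ?k\<close> by simp
          then show ?thesis using i False unfolding g by simp
        qed
      qed (use \<gamma>0c(1) in simp)
      also have "\<dots> = transpose_mat \<gamma>0 *\<^sub>v (c \<cdot>\<^sub>v p)"
        using \<gamma>0c(1) pc(1) by (intro mult_mat_vec[symmetric]) auto
      finally have "r = c \<cdot>\<^sub>v p"
        using unimodular_transpose_cancel[OF \<gamma>0 Uc(1)[OF that], of "c \<cdot>\<^sub>v p"] pc(1) by simp
      then have "r = p" using forms_not_proportional[OF Uc(3)[OF that] p(1)] by blast
      then show False using p(2) that by blast
    qed
  qed
  \<comment> \<open>Different forms may become proportional on the hyperplane. Normalization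
    requires these to be equal, so each is replaced by the chosen primitive form on its
    line.\<close>
  define pf where "pf r = prim_form (restr r)" for r
  have pf: "primitive_integral (pf r)" "pf r \<in> carrier_vec ?k" if "r \<in># U" for r
    using prim_form_props[OF restr[OF that]] unfolding pf_def by auto
  have "\<forall>r. \<exists>d. r \<in># U \<longrightarrow> \<bar>d\<bar> \<ge> 1 \<and> restr r = d \<cdot>\<^sub>v pf r"
    using prim_form_props(3)[OF restr] unfolding pf_def by blast
  then obtain d where d: "\<And>r. r \<in># U \<Longrightarrow> \<bar>d r\<bar> \<ge> 1" "\<And>r. r \<in># U \<Longrightarrow> restr r = d r \<cdot>\<^sub>v pf r"
    by metis
  obtain ws where ws: "mset ws = image_mset pf U" "adjacent_classes ws"
    using ex_adjacent_arrangement by blast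
  have ws_len: "length ws = n" using arg_cong[OF ws(1), of size] U'(1) by simp
  have ws_set: "set ws = pf ` set_mset U" using arg_cong[OF ws(1), of set_mset] by simp
  \<comment> \<open>A vector orthogonal to all restricted forms, extended by a last coordinate 0 and
    moved back by \<open>\<gamma>0\<close>, is orthogonal to all of \<open>U\<close>, hence
    zero.\<close>
  have nd: "nondegenerate ?k (set ws)"
    unfolding nondegenerate_def
  proof (intro ballI impI)
    fix y assume y: "y \<in> carrier_vec ?k" and perp: "\<forall>w\<in>set ws. y \<bullet> w = 0"
    define y' where "y' = y @\<^sub>v 0\<^sub>v 1"
    have y': "y' \<in> carrier_vec l" "vec_first y' ?k = y" "y' $ ?k = 0"
      using y l_pos by (auto simp: y'_def vec_first_append intro!: carrier_vecI)
    have "(\<gamma>0 *\<^sub>v y') \<bullet> r = 0" if "r \<in># U" for r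
    proof -
      have "(\<gamma>0 *\<^sub>v y') \<bullet> r = y' \<bullet> (transpose_mat \<gamma>0 *\<^sub>v r)"
        using transpose_mult_vec_scalar_prod[OF \<gamma>0c(1) Uc(1)[OF that] y'(1)] by simp
      also have "\<dots> = y \<bullet> restr r"
        unfolding restr_def y'(2)[symmetric]
      proof (intro scalar_prod_vec_first[OF y'(1) trc[OF Uc(1)[OF that]]])
        fix i assume "i < l" "?k \<le> i"
        then have "i = ?k" by simp
        then show "y' $ i = 0" using y'(3) by simp
      qed simp
      also have "\<dots> = d r * (y \<bullet> pf r)" using d(2)[OF that] y pf(2)[OF that] by simp
      also have "\<dots> = 0" using perp ws_set that by simp
      finally show ?thesis .
    qed
    then have "\<gamma>0 *\<^sub>v y' = 0\<^sub>v l"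
      using U'(3) \<gamma>0c(1) y'(1) by (intro nondegenerateD[OF U'(3)]) auto
    moreover obtain \<delta> where \<delta>: "\<delta> \<in> carrier_mat l l" "\<delta> * \<gamma>0 = 1\<^sub>m l"
      using \<gamma>0 by (auto simp: unimodular_def)
    ultimately have "y' = \<delta> *\<^sub>v 0\<^sub>v l"
      using assoc_mult_mat_vec[OF \<delta>(1) \<gamma>0c(1) y'(1)] y'(1) by simp
    then have "y' = 0\<^sub>v l" using \<delta>(1) by (intro eq_vecI) auto
    then show "y = 0\<^sub>v ?k" using y'(2) by (auto simp: vec_first_def)
  qed
  \<comment> \<open>Replacing each restricted form by its primitive one removes the factors
    \<open>d r\<close> from the denominators. This is the determinant that \<open>\<tau>\<close>
    needs in order to compensate.\<close>
  define c where "c = det \<sigma> / (\<Prod>r\<in>#U. d r)"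
  have d_nonzero: "d r \<noteq> 0" if "r \<in># U" for r using d(1)[OF that] by auto
  then have "(\<Prod>r\<in>#U. d r) \<noteq> 0" by (auto simp: prod_mset_zero_iff)
  then have c0: "c \<noteq> 0" using det_nonzero by (simp add: c_def)
  have kn: "?k < n" "?k \<le> n" using l_pos l_le_n by auto
  have wsc: "set ws \<subseteq> carrier_vec ?k" using pf(2) ws_set by auto
  have ws_int: "integral_vec w" if "w \<in> set ws" for w
    using pf(1) that ws_set primitive_integral_imp_integral by auto
  obtain \<tau> q' where \<tau>: "\<tau> \<in> carrier_mat n n" "\<And>j. j < n \<Longrightarrow> proj_col ?k \<tau> j = ws ! j"
      "c = of_rat q' * det \<tau>" "?k < n \<Longrightarrow> q' = 1"
    using realize_columns_by_matrix[OF ws_len wsc kn(2) nd ws_int c0] kn(1)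
    by (metis less_irrefl)
  \<comment> \<open>Because \<open>l - 1 < n\<close>, there are free rows, and the possibly
    irrational value \<open>c\<close> can be met exactly, without a rational correction.\<close>
  have det\<tau>: "det \<tau> = c" using \<tau>(3,4) kn(1) by simp
  have img: "proj_col ?k \<tau> ` {..<n} = set ws"
    using \<tau>(2) ws_len by (auto simp: set_conv_nth)
  have "normalized n ?k (Z_span n ?k) \<tau>"
  proof (rule normalizedI[OF ws_len \<tau>(2) ws(2)])
    show "primitive_integral w" if "w \<in> set ws" for w using pf(1) ws_set that by auto
    show "w = w'" if w: "w \<in> set ws" "w' \<in> set ws" "w = b \<cdot>\<^sub>v w'" for w w' b
    proof -
      \<comment> \<open>\<open>prim_form\<close> is constant on lines and fixes its own values, so
        proportional entries of \<open>ws\<close> coincide.\<close>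
      have fix_pf: "prim_form z = z \<and> z \<noteq> 0\<^sub>v ?k \<and> z \<in> carrier_vec ?k" if "z \<in> set ws" for z
      proof -
        obtain r where r: "r \<in># U" "z = pf r" using \<open>z \<in> set ws\<close> ws_set by auto
        have "prim_form (restr r) = prim_form (pf r)"
          using d(2)[OF r(1)] prim_form_smult[OF d_nonzero[OF r(1)], of "pf r"] by simp
        then show ?thesis using r pf[OF r(1)] primitive_integral_nonzero by (simp add: pf_def)
      qed
      have "b \<noteq> 0"
      proof
        assume "b = 0"
        then have "w = 0\<^sub>v ?k" using w(3) fix_pf[OF w(2)] by (intro eq_vecI) auto
        then show False using fix_pf[OF w(1)] by blast
      qed
      then show ?thesis using prim_form_smult[of b w'] w(3) fix_pf[OF w(1)] fix_pf[OF w(2)] by metis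
    qed
  qed
  moreover have "dedekind_index n ?k \<tau> \<le> dedekind_index n l \<sigma>"
  proof (rule dedekind_index_le[OF kn(2)])
    fix xs assume xs: "length xs = ?k" "set xs \<subseteq> proj_col ?k \<tau> ` {..<n}"
    \<comment> \<open>Several forms of \<open>U\<close> may share a primitive restriction; any
      choice of preimages will do. Passing from \<open>xs\<close> to the restrictions of these
      preimages multiplies the minor by factors \<open>d r\<close>, and adjoining \<open>p\<close>
      multiplies it by \<open>g\<close>, all of absolute value at least 1.\<close>
    have "\<forall>x\<in>set xs. \<exists>r. r \<in># U \<and> pf r = x" using xs(2) unfolding img ws_set by blast
    then obtain f where f: "\<And>x. x \<in> set xs \<Longrightarrow> f x \<in># U \<and> pf (f x) = x" by metis
    define rs where "rs = map f xs"
    have rs: "length rs = ?k" "set rs \<subseteq> set_mset U" "map pf rs = xs"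
      using xs(1) f by (auto simp: rs_def map_idI)
    let ?D = "\<Prod>i=0..<?k. d (rs ! i)"
    have "restr r = d r \<cdot>\<^sub>v pf r" if "r \<in> set rs" for r using rs(2) d(2) that by auto
    then have "map restr rs = map (\<lambda>r. d r \<cdot>\<^sub>v pf r) rs" by simp
    moreover have "pf r \<in> carrier_vec ?k" if "r \<in> set rs" for r using rs(2) pf(2) that by auto
    ultimately have "det (mat_of_cols ?k (map restr rs)) = ?D * det (mat_of_cols ?k xs)"
      using det_mat_of_cols_smult[OF rs(1), of pf d] rs(3) by metis
    moreover have "\<bar>?D\<bar> \<ge> 1"
      unfolding abs_prod using rs(1,2) d(1) by (intro prod_ge_1) (auto simp: subset_iff)
    ultimately have "\<bar>det (mat_of_cols ?k xs)\<bar> \<le> \<bar>det (mat_of_cols ?k (map restr rs))\<bar>"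
      by (simp add: abs_mult mult_le_cancel_right1)
    also have "\<dots> \<le> \<bar>det (mat_of_cols ?k (map restr rs))\<bar> * \<bar>g\<bar>"
      using g1 by (simp add: mult_le_cancel_left1)
    also have "\<dots> = \<bar>det (mat_of_cols l (rs @ [p]))\<bar>"
    proof -
      have "set rs \<subseteq> carrier_vec l" using rs(2) Uc(1) by auto
      from det_restrict_to_hyperplane[OF l_pos \<gamma>0 pc(1) g rs(1) this] show ?thesis
        unfolding restr_def by simp
    qed
    also have "\<dots> \<le> dedekind_index n l \<sigma>"
      using rs(1,2) l_pos p(1) U'(2) by (intro dedekind_index_ge[OF l_le_n]) auto
    finally show "\<bar>det (mat_of_cols ?k xs)\<bar> \<le> dedekind_index n l \<sigma>" .
  qed
  ultimately have low: "(\<tau>, \<gamma>) \<in> lower_sums" using \<tau>(1) cc by (auto simp: lower_sums_def)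
  have "dedekind_sum_in \<gamma> (Z_span n ?k) \<tau> e v Q = h"
  proof (rule dedekind_sum_in_eqI[OF h _ \<gamma>c bij])
    show "H \<subseteq> Z_span n l" by (auto simp: H_def)
    show "Z_span n ?k \<subseteq> carrier_vec n" by (auto simp: Z_span_def)
    show "set Q \<subseteq> carrier_vec n" using Q by (auto simp: Q_forms_def)
    fix y assume y: "y \<in> Z_span n ?k"
    have "(\<Prod>r\<in>#U. inverse (vec_first (\<gamma> *\<^sub>v y) l \<bullet> r)) =
        (\<Prod>r\<in>#U. inverse (d r) * inverse (vec_first y ?k \<bullet> pf r))"
    proof (intro arg_cong[of _ _ prod_mset] image_mset_cong)
      fix r assume r: "r \<in># U"
      show "inverse (vec_first (\<gamma> *\<^sub>v y) l \<bullet> r) = inverse (d r) * inverse (vec_first y ?k \<bullet> pf r)"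
        using pairing_K[OF y Uc(1)[OF r]] d(2)[OF r] pf(2)[OF r] by (simp add: inverse_mult_distrib)
    qed
    also have "\<dots> = inverse (\<Prod>r\<in>#U. d r) * (\<Prod>w\<in>#mset ws. inverse (vec_first y ?k \<bullet> w))"
      unfolding ws(1) by (induction U) (auto simp: multiset.map_comp comp_def)
    finally have "det \<sigma> * (\<Prod>r\<in>#U. inverse (vec_first (\<gamma> *\<^sub>v y) l \<bullet> r)) =
        c * (\<Prod>w\<in>#mset ws. inverse (vec_first y ?k \<bullet> w))"
      by (simp add: c_def divide_inverse)
    moreover have "y \<bullet> (transpose_mat \<gamma> *\<^sub>v v) = (\<gamma> *\<^sub>v y) \<bullet> v"
      using transpose_mult_vec_scalar_prod[OF \<gamma>c v] Z_spanD(1)[OF y] by blast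
    ultimately have "form_term ?k c (transpose_mat \<gamma> *\<^sub>v v) (mset ws) y = term_of U (\<gamma> *\<^sub>v y)"
      unfolding form_term_def by (simp only:)
    then show "dedekind_term \<tau> e (transpose_mat \<gamma> *\<^sub>v v) y = term_of U (\<gamma> *\<^sub>v y)"
      using dedekind_term_conv_form_term[OF \<tau>(1) kn(2) y ws_len \<tau>(2) e] det\<tau> by simp
  qed
  with reducible_lower[OF low] have "h \<in> reducible" by simp
  moreover have "sums_to (\<lambda>x. if vec_first x l \<bullet> p = 0 then term_of U x else 0) h"
    using h by (subst Q_sums_cong[of _ _ "\<lambda>x. if x \<in> H then term_of U x else 0"]) (auto simp: H_def)
  ultimately show ?thesis by blast
qed

text \<open>Two nested inductions. The outer one is on the number of distinct forms. The inner one
  keeps the set of forms fixed, so that one linear relation serves throughout, and counts the copies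
  of the forms on its right-hand side: each exchange turns one of these into a copy of
  \<open>p0\<close>, which is not among them. Either the count drops or a form disappears.\<close>

lemma admissible_reducible:
  assumes "admissible U"
  shows "\<exists>s\<in>reducible. sums_to (term_of U) s"
  using assms
proof (induction "card (set_mset U)" arbitrary: U rule: less_induct)
  case (less U)
  define A where "A = set_mset U"
  have A: "A \<subseteq> forms" "nondegenerate l A"
    using less.prems by (auto simp: admissible_def A_def)
  have Ac: "A \<subseteq> carrier_vec l" "\<And>r. r \<in> A \<Longrightarrow> integral_vec r" using A(1) forms_props by auto
  obtain ps where ps: "length ps = l" "set ps \<subseteq> A" "det (mat_of_cols l ps) \<noteq> 0"
    using nondegenerate_obtains_basis[OF A(2) Ac(1)] by blast
  have psc: "set ps \<subseteq> carrier_vec l" using ps(2) Ac(1) by auto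
  have dist: "distinct ps" by (rule distinct_if_det_mat_of_cols_nonzero[OF ps(1) psc ps(3)])
  show ?case
  proof (cases "A = set ps")
    case True
    then have "card (set_mset U) = l" using dist ps(1) by (simp add: A_def distinct_card)
    then show ?thesis using diagonal_case[OF less.prems] by blast
  next
    case False
    then obtain p0 where p0: "p0 \<in> A" "p0 \<notin> set ps" using ps(2) by auto
    obtain a where a: "\<And>x. x \<in> carrier_vec l \<Longrightarrow> x \<bullet> p0 = (\<Sum>i<l. of_rat (a i) * (x \<bullet> ps ! i))"
      using rational_combination_of_basis[OF ps(1) psc ps(3)] Ac p0(1) ps(2) by (metis subsetD)
    define b where "b r = a (inv_into {..<l} ((!) ps) r)" for r
    have bij: "bij_betw ((!) ps) {..<l} (set ps)" using bij_betw_nth[OF dist] ps(1) by auto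
    \<comment> \<open>Only forms with nonzero coefficient are exchanged. When one of them
      disappears, the relation can be solved for it, which preserves spanning.\<close>
    define I where "I = {r \<in> set ps. b r \<noteq> 0}"
    have I: "finite I" "I \<subseteq> A" "p0 \<notin> I" "\<And>r. r \<in> I \<Longrightarrow> b r \<noteq> 0"
      using ps(2) p0(2) by (auto simp: I_def)
    have rel: "x \<bullet> p0 = (\<Sum>r\<in>I. of_rat (b r) * (x \<bullet> r))" if "x \<in> carrier_vec l" for x
    proof -
      have "x \<bullet> p0 = (\<Sum>i<l. of_rat (b (ps ! i)) * (x \<bullet> ps ! i))"
        unfolding a[OF that] b_def using bij
        by (intro sum.cong) (auto simp: bij_betw_inv_into_left[OF bij])
      also have "\<dots> = (\<Sum>r\<in>set ps. of_rat (b r) * (x \<bullet> r))"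
        by (rule sum.reindex_bij_betw[OF bij])
      also have "\<dots> = (\<Sum>r\<in>I. of_rat (b r) * (x \<bullet> r))"
        by (intro sum.mono_neutral_right) (auto simp: I_def)
      finally show ?thesis .
    qed
    have "\<exists>s\<in>reducible. sums_to (term_of W) s" if "admissible W" "set_mset W = A" for W
      using that
    proof (induction "size (filter_mset (\<lambda>r. r \<in> I) W)" arbitrary: W rule: less_induct)
      case inner: (less W)
      note W = \<open>set_mset W = A\<close>
      have size: "size W = n" using inner.prems(1) by (simp add: admissible_def)
      define V where "V i = add_mset p0 (W - {#i#})" for i
      let ?F = "\<lambda>i x. if vec_first x l \<bullet> i = 0 then 0 else term_of (V i) x"
      have part: "\<exists>s\<in>reducible. sums_to (?F i) s" if i: "i \<in> I" for i
      proof -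
        have iW: "i \<in># W" using i I(2) W by auto
        have "i \<noteq> p0" using i I(3) by auto
        have "size (add_mset i (W - {#i#})) = n" unfolding insert_DiffM[OF iW] by (rule size)
        then have sizeV: "size (V i) = n" by (simp add: V_def)
        have V_sub: "set_mset (V i) \<subseteq> A" using p0(1) W by (auto simp: V_def dest: in_diffD)
        show ?thesis
        proof (cases "i \<in># W - {#i#}")
          case True
          have "set_mset (V i) = A"
          proof (intro equalityI V_sub subsetI)
            fix r assume "r \<in> A"
            then show "r \<in># V i" using True W unfolding V_def
              by (cases "r = i") (auto simp: in_diff_count)
          qed
          moreover have "admissible (V i)"
            using sizeV calculation inner.prems(1) W by (simp add: admissible_def)
          moreover have "size (filter_mset (\<lambda>r. r \<in> I) (V i)) < size (filter_mset (\<lambda>r. r \<in> I) W)"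
          proof -
            obtain W' where "W = add_mset i W'" using iW by (metis insert_DiffM)
            then show ?thesis using i I(3) by (simp add: V_def)
          qed
          ultimately obtain s where s: "s \<in> reducible" "sums_to (term_of (V i)) s"
            using inner.hyps[of "V i"] by blast
          \<comment> \<open>As long as a copy of \<open>i\<close> remains, the zeros of
            \<open>i\<close> are omitted automatically and no correction on the hyperplane
            arises.\<close>
          have "term_of (V i) x = 0" if "vec_first x l \<bullet> i = 0" for x
          proof -
            have "i \<in># V i" using True by (simp add: V_def)
            then have "(\<Prod>r\<in>#V i. inverse (vec_first x l \<bullet> r)) = 0"
              using that by (auto simp: prod_mset_zero_iff intro!: image_eqI[of _ _ i])
            then show ?thesis by (simp add: form_term_def)
          qed
          then have "?F i = term_of (V i)" by auto
          then show ?thesis using s by auto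
        next
          case False
          have setV: "set_mset (V i) = A - {i}"
          proof (intro equalityI subsetI)
            fix r assume "r \<in> set_mset (V i)"
            then show "r \<in> A - {i}" using V_sub False \<open>i \<noteq> p0\<close> by (auto simp: V_def)
          next
            fix r assume "r \<in> A - {i}"
            then show "r \<in> set_mset (V i)" using W by (auto simp: V_def in_diff_count)
          qed
          \<comment> \<open>The relation expresses \<open>i\<close> through \<open>p0\<close> and
            the other forms in \<open>I\<close>, all of which stay.\<close>
          have "nondegenerate l (A - {i})"
            unfolding nondegenerate_def
          proof (intro ballI impI)
            fix x :: "real vec" assume x: "x \<in> carrier_vec l" and perp: "\<forall>r\<in>A - {i}. x \<bullet> r = 0"
            have "0 = x \<bullet> p0" using perp p0(1) \<open>i \<noteq> p0\<close> by simp
            also have "\<dots> = of_rat (b i) * (x \<bullet> i) + (\<Sum>r\<in>I - {i}. of_rat (b r) * (x \<bullet> r))"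
              unfolding rel[OF x] by (rule sum.remove[OF I(1) i])
            also have "(\<Sum>r\<in>I - {i}. of_rat (b r) * (x \<bullet> r)) = 0"
              using perp I(2) by (intro sum.neutral) auto
            finally have "x \<bullet> i = 0" using I(4)[OF i] by simp
            then show "x = 0\<^sub>v l" using perp by (intro nondegenerateD[OF A(2) x]) auto
          qed
          then have adm: "admissible (V i)"
            using sizeV setV A(1) by (auto simp: admissible_def)
          have "i \<in> A" using i I(2) by auto
          have "card (A - {i}) < card A" using \<open>i \<in> A\<close> by (intro psubset_card_mono) (auto simp: A_def)
          then obtain s where s: "s \<in> reducible" "sums_to (term_of (V i)) s"
            using less.hyps[of "V i"] adm setV unfolding A_def by auto
          have "i \<in> forms" "i \<notin># V i" using \<open>i \<in> A\<close> A(1) setV by auto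
          from hyperplane_case[OF adm this] obtain s' where
            s': "s' \<in> reducible" "sums_to (\<lambda>x. if vec_first x l \<bullet> i = 0 then term_of (V i) x else 0) s'"
            by blast
          \<comment> \<open>The restricted summand is the full one, which has fewer distinct forms,
            minus its part on the hyperplane of \<open>i\<close>, which has lower rank.\<close>
          have "?F i = (\<lambda>x. term_of (V i) x - (if vec_first x l \<bullet> i = 0 then term_of (V i) x else 0))"
            by auto
          then have "sums_to (?F i) (s - s')" using Q_sums_diff[OF s(2) s'(2)] by simp
          then show ?thesis using reducible_diff[OF s(1) s'(1)] by blast
        qed
      qed
      then have "\<forall>i\<in>I. \<exists>s. s \<in> reducible \<and> sums_to (?F i) s" by blast
      then obtain s where s: "\<And>i. i \<in> I \<Longrightarrow> s i \<in> reducible" "\<And>i. i \<in> I \<Longrightarrow> sums_to (?F i) (s i)"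
        unfolding bchoice_iff by blast
      have "sums_to (\<lambda>x. \<Sum>i\<in>I. of_rat (b i) * ?F i x) (\<Sum>i\<in>I. of_rat (b i) * s i)"
        using I(1) s(2) by (intro Q_sums_sum Q_sums_cmult)
      moreover have "(\<Sum>i\<in>I. of_rat (b i) * ?F i x) = term_of W x" for x
      proof -
        let ?y = "vec_first x l"
        have "(\<Prod>r\<in>#W. inverse (?y \<bullet> r)) = (\<Sum>i\<in>I. of_rat (b i) *
            (if ?y \<bullet> i = 0 then 0 else (\<Prod>r\<in>#V i. inverse (?y \<bullet> r))))"
          unfolding V_def using p0(1) W I(2) rel[of ?y] by (intro partial_fraction_step) auto
        then have "term_of W x = exp (2 * of_real pi * \<i> * of_real (x \<bullet> v)) * of_real (det \<sigma> *
            (\<Sum>i\<in>I. of_rat (b i) * (if ?y \<bullet> i = 0 then 0 else (\<Prod>r\<in>#V i. inverse (?y \<bullet> r)))))"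
          by (simp only: form_term_def)
        also have "\<dots> = (\<Sum>i\<in>I. of_rat (b i) * ?F i x)"
          unfolding sum_distrib_left of_real_sum
          by (intro sum.cong refl) (simp add: form_term_def of_real_of_rat mult_ac)
        finally show ?thesis by simp
      qed
      ultimately have "sums_to (term_of W) (\<Sum>i\<in>I. of_rat (b i) * s i)" by simp
      moreover have "(\<Sum>i\<in>I. of_rat (b i) * s i) \<in> reducible"
        using I(1) s(1) by (intro reducible_sum reducible_scale)
      ultimately show ?case by blast
    qed
    then show ?thesis using less.prems A_def by blast
  qed
qed

text \<open>The reduction yields some reducible \<open>Q\<close>-limit of the terms. The matrix
  \<open>\<sigma>\<close> realizes the multiset of its own forms with factor 1, so uniqueness of
  limits identifies that value with the given sum.\<close>

lemma dedekind_sum_reducible: "dedekind_sum (Z_span n l) \<sigma> e v Q \<in> reducible"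
proof -
  define us where "us = map (proj_col l \<sigma>) [0..<n]"
  have us: "length us = n" "\<And>j. j < n \<Longrightarrow> proj_col l \<sigma> j = us ! j" "set us = forms"
    by (auto simp: us_def atLeast0LessThan)
  have "nondegenerate l forms"
    unfolding nondegenerate_def
  proof (intro ballI impI)
    fix y assume y: "y \<in> carrier_vec l" and perp: "\<forall>p\<in>forms. y \<bullet> p = 0"
    \<comment> \<open>Padding \<open>y\<close> by zeros gives a vector in the kernel of the
      transpose of \<open>\<sigma>\<close>, which is trivial because \<open>det \<sigma>\<close> is
      nonzero.\<close>
    define x where "x = y @\<^sub>v 0\<^sub>v (n - l)"
    have x: "x \<in> carrier_vec n" "vec_first x l = y" "\<And>i. i < n \<Longrightarrow> l \<le> i \<Longrightarrow> x $ i = 0"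
      using y l_le_n by (auto simp: x_def vec_first_append intro!: carrier_vecI)
    have "transpose_mat \<sigma> *\<^sub>v x = 0\<^sub>v n"
    proof (intro eq_vecI)
      fix j assume "j < dim_vec (0\<^sub>v n :: real vec)"
      then have j: "j < n" by simp
      have cj: "col \<sigma> j \<in> carrier_vec n" using \<sigma> by (metis col_dim carrier_matD(1))
      have "col \<sigma> j \<bullet> x = x \<bullet> col \<sigma> j" by (rule comm_scalar_prod[OF cj x(1)])
      also have "\<dots> = y \<bullet> proj_col l \<sigma> j"
        using scalar_prod_vec_first[OF x(1) cj l_le_n x(3)] x(2) by (simp add: proj_col_def)
      also have "\<dots> = 0" using perp j by simp
      finally show "(transpose_mat \<sigma> *\<^sub>v x) $ j = 0\<^sub>v n $ j" using j \<sigma> by simp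
    qed (use \<sigma> in simp)
    moreover have "det (transpose_mat \<sigma>) \<noteq> 0" using det_nonzero det_transpose[OF \<sigma>] by simp
    ultimately have "x = 0\<^sub>v n"
      using det_0_iff_vec_prod_zero_field[of "transpose_mat \<sigma>" n] \<sigma> x(1) by auto
    then show "y = 0\<^sub>v l" using x(2) l_le_n by (auto simp: vec_first_def)
  qed
  then have "admissible (mset us)" using us by (auto simp: admissible_def)
  then obtain s where s: "s \<in> reducible" "sums_to (term_of (mset us)) s"
    using admissible_reducible by blast
  have "sums_to (\<lambda>x. if x \<in> Z_span n l then term_of (mset us) x else 0)
      (of_rat 1 * dedekind_sum (Z_span n l) \<sigma> e v Q)"
    using us \<sigma> Z_span_subgroup by (intro sums_to_realized[of _ _ us]) (auto simp: Z_span_def)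
  then have "sums_to (term_of (mset us)) (dedekind_sum (Z_span n l) \<sigma> e v Q)"
    by (subst Q_sums_cong[of _ _ "\<lambda>x. if x \<in> Z_span n l then term_of (mset us) x else 0"]) auto
  with s show ?thesis using Q_sums_unique by blast
qed

end

theorem theorem4p2:
  fixes n l :: nat and \<sigma> :: "real mat" and e :: "nat \<Rightarrow> nat"
    and v :: "real vec" and Q :: "real vec list"
  assumes "1 \<le> l" and "l \<le> n"
    and "\<sigma> \<in> carrier_mat n n" and "v \<in> carrier_vec n"
    and "Q_forms n Q" and "Q_limits_exist n Q"
    and "normalized n l (Z_span n l) \<sigma>"
    and "properly_embedded n e"
  shows "\<exists>(R :: real mat set) (T :: (real mat \<times> real mat) set)
            (qR :: real mat \<Rightarrow> rat) (qT :: real mat \<times> real mat \<Rightarrow> rat).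
    finite R \<and> finite T \<and>
    (\<forall>\<rho>\<in>R. \<rho> \<in> carrier_mat n n \<and> normalized n l (Z_span n l) \<rho> \<and> diagonal n l \<rho> \<and>
        dedekind_index n l \<rho> \<le> dedekind_index n l \<sigma>) \<and>
    (\<forall>(\<tau>, \<gamma>)\<in>T. \<tau> \<in> carrier_mat n n \<and> coord_change n l \<gamma> \<and>
        normalized n (l - 1) (Z_span n (l - 1)) \<tau> \<and>
        dedekind_index n (l - 1) \<tau> \<le> dedekind_index n l \<sigma>) \<and>
    dedekind_sum (Z_span n l) \<sigma> e v Q =
      (\<Sum>\<rho>\<in>R. of_rat (qR \<rho>) * dedekind_sum (Z_span n l) \<rho> e v Q) +
      (\<Sum>(\<tau>, \<gamma>)\<in>T. of_rat (qT (\<tau>, \<gamma>)) * dedekind_sum_in \<gamma> (Z_span n (l - 1)) \<tau> e v Q)"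
proof (cases "det \<sigma> = 0")
  case True
  then have "truncated_dedekind_sum (Z_span n l) \<sigma> e v Q = (\<lambda>_. 0)"
    unfolding truncated_dedekind_sum_def dedekind_term_def by auto
  then have "dedekind_sum (Z_span n l) \<sigma> e v Q = 0"
    unfolding dedekind_sum_def by (simp add: tendsto_Lim)
  then show ?thesis by (intro exI[of _ "{}"] exI[of _ "\<lambda>_. 0"]) simp
next
  case False
  interpret dedekind_data n l \<sigma> e v Q by unfold_locales (use assms False in auto)
  obtain R T qR qT where R: "finite R" "R \<subseteq> diagonals" and T: "finite T" "T \<subseteq> lower_sums"
    and eq: "dedekind_sum (Z_span n l) \<sigma> e v Q =
      (\<Sum>\<rho>\<in>R. of_rat (qR \<rho>) * dedekind_sum (Z_span n l) \<rho> e v Q) +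
      (\<Sum>b\<in>T. of_rat (qT b) * (case b of (\<tau>, \<gamma>) \<Rightarrow> dedekind_sum_in \<gamma> (Z_span n (l - 1)) \<tau> e v Q))"
    using dedekind_sum_reducible unfolding reducible_def rat_span_def by auto
  show ?thesis
  proof (intro exI[of _ R] exI[of _ T] exI[of _ qR] exI[of _ qT] conjI)
    show "dedekind_sum (Z_span n l) \<sigma> e v Q =
        (\<Sum>\<rho>\<in>R. of_rat (qR \<rho>) * dedekind_sum (Z_span n l) \<rho> e v Q) +
        (\<Sum>(\<tau>, \<gamma>)\<in>T. of_rat (qT (\<tau>, \<gamma>)) * dedekind_sum_in \<gamma> (Z_span n (l - 1)) \<tau> e v Q)"
      unfolding eq by (simp add: case_prod_beta)
  qed (use R T in \<open>auto simp: diagonals_def lower_sums_def\<close>)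
qed

end
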